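(* Suppose $0<\beta\ll\alpha\ll 1$ and $n$ is sufficiently large; that is, there is $\alpha_0>0$ such that for every $0<\alpha\le\alpha_0$ there is $\beta_0>0$ such that for every $0<\beta\le\beta_0$ there is $n_0$ such that for all $n\ge n_0$ the following holds. Let $G$ be a $3$-connected graph on $n$ vertices with $\delta(G)\ge (2n+3)/5$. If there is a partition $V(G)=V_1\cup V_2$ with $|V_i|\ge (2/5-4\beta)n$ for $i=1,2$, $d(V_1,V_2)<\alpha$, and $\deg(v_1,V_2)\le 2\beta n$ for every $v_1\in V_1$, then $G$ contains a spanning generalized Halin graph.
   Context: All graphs are finite and simple. $\deg(v,S)$ is the number of neighbors of $v$ in $S$; $d(V_1,V_2)=e(V_1,V_2)/(|V_1||V_2|)$ where $e(V_1,V_2)$ is the number of edges with one end in $V_1$ and the other in $V_2$. For a tree $T$, $L(T)$ is its set of leaves; a HIST of $G$ is a spanning tree with no vertex of degree $2$; a spanning generalized Halin graph of $G$ is a spanning subgraph $T\cup C$ of $G$ with $T$ a HIST of $G$ and $C$ a cycle of $G$ with $V(C)=L(T)$. *)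

theory Defs
  imports Complex_Main "Graph_Theory.Digraph_Component"
begin

text \<open>
  A finite simple graph is a \<^const>\<open>pair_graph\<close>: a finite, loop-free, symmetric relation on a finite
  vertex set.  An undirected edge \<open>uv\<close> is the pair of arcs \<open>(u,v)\<close>, \<open>(v,u)\<close>, so the degree of a
  vertex is its \<^const>\<open>out_degree\<close>.
\<close>

definition deg_in :: "'a pair_pre_digraph \<Rightarrow> 'a \<Rightarrow> 'a set \<Rightarrow> nat" where
  "deg_in G v S = card {u \<in> S. (v, u) \<in> parcs G}"

definition min_degree :: "'a pair_pre_digraph \<Rightarrow> nat" where
  "min_degree G = Min (out_degree (with_proj G) ` pverts G)"

definition edges_between :: "'a pair_pre_digraph \<Rightarrow> 'a set \<Rightarrow> 'a set \<Rightarrow> 'a set set" where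
  "edges_between G A B = {{u, v} | u v. u \<in> A \<and> v \<in> B \<and> (u, v) \<in> parcs G}"

definition density :: "'a pair_pre_digraph \<Rightarrow> 'a set \<Rightarrow> 'a set \<Rightarrow> real" where
  "density G A B = real (card (edges_between G A B)) / (real (card A) * real (card B))"

definition k_connected :: "nat \<Rightarrow> 'a pair_pre_digraph \<Rightarrow> bool" where
  "k_connected k G \<longleftrightarrow> k < card (pverts G) \<and>
     (\<forall>S \<subseteq> pverts G. card S < k \<longrightarrow> connected (with_proj G \<restriction> (pverts G - S)))"

text \<open>
  In a symmetric digraph the closed walk \<open>u, v, u\<close> counts as a \<^const>\<open>pre_digraph.cycle\<close>; the cycles
  of the underlying undirected graph are those of length at least 3.  For the same reason the
  library's \<^const>\<open>forest\<close> and \<^const>\<open>tree\<close> exclude every symmetric digraph with an arc and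
  cannot be used here.
\<close>

definition graph_cycle :: "'a pair_pre_digraph \<Rightarrow> ('a \<times> 'a) list \<Rightarrow> bool" where
  "graph_cycle G p \<longleftrightarrow> pre_digraph.cycle (with_proj G) p \<and> 3 \<le> length p"

definition is_cycle :: "'a pair_pre_digraph \<Rightarrow> bool" where
  "is_cycle C \<longleftrightarrow> pair_graph C \<and>
     (\<exists>p. graph_cycle C p \<and> pverts C = fst ` set p \<and> parcs C = set p \<union> (set p)\<inverse>)"

definition is_tree :: "'a pair_pre_digraph \<Rightarrow> bool" where
  "is_tree T \<longleftrightarrow> pair_graph T \<and> connected (with_proj T) \<and> (\<nexists>p. graph_cycle T p)"

definition leaves :: "'a pair_pre_digraph \<Rightarrow> 'a set" where
  "leaves T = {v \<in> pverts T. out_degree (with_proj T) v = 1}"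

definition is_HIST :: "'a pair_pre_digraph \<Rightarrow> 'a pair_pre_digraph \<Rightarrow> bool" where
  "is_HIST T G \<longleftrightarrow> is_tree T \<and> spanning (with_proj T) (with_proj G) \<and>
     (\<forall>v \<in> pverts T. out_degree (with_proj T) v \<noteq> 2)"

definition spanning_generalized_Halin :: "'a pair_pre_digraph \<Rightarrow> 'a pair_pre_digraph \<Rightarrow> bool" where
  "spanning_generalized_Halin H G \<longleftrightarrow> spanning (with_proj H) (with_proj G) \<and>
     (\<exists>T C. is_HIST T G \<and> is_cycle C \<and> subgraph (with_proj C) (with_proj G) \<and>
        pverts C = leaves T \<and> with_proj H = union (with_proj T) (with_proj C))"

end

theory Submission
  imports Defs
begin

text \<open>
  Moving the few vertices of \<open>V2\<close> with many neighbours in \<open>V1\<close> over to \<open>V1\<close> gives a partition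
  \<open>A \<union> B\<close> in which all but a tiny fraction of the vertices see clearly more than half of their own
  part, and the remaining ones still see linearly many vertices of \<open>A\<close>.  By 3-connectivity there are
  three disjoint edges \<open>x1 y1\<close>, \<open>x2 y2\<close>, \<open>x3 y3\<close> between the parts.  A small dominating set
  avoiding \<open>x1, x2, y1, y2\<close> is joined, inside each part, to a hub, and the two hubs are connected
  through \<open>x3 y3\<close>; the result is a small connected dominating set \<open>I\<close>.  A spanning tree of
  \<open>G[I]\<close>, with all other vertices hung on as leaves so that every vertex of \<open>I\<close> gets at least three
  of them, is a HIST with leaf set \<open>V - I\<close>.  The degree condition survives the deletion of \<open>I\<close>, so the
  Bondy--Chvatal closure yields a Hamiltonian \<open>x1\<close>-\<open>x2\<close> path of \<open>G[A - I]\<close> and a Hamiltonian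
  \<open>y2\<close>-\<open>y1\<close> path of \<open>G[B - I]\<close>, and together with \<open>x1 y1\<close>, \<open>x2 y2\<close> they form the required cycle.
\<close>

section \<open>Hamiltonian paths with prescribed ends\<close>

definition nbrs :: "'a rel \<Rightarrow> 'a \<Rightarrow> 'a set \<Rightarrow> 'a set" where
  "nbrs E v S = {u \<in> S. (v, u) \<in> E}"

lemma nbrs_subset: "nbrs E v S \<subseteq> S"
  by (auto simp: nbrs_def)

lemma finite_nbrs [simp]: "finite S \<Longrightarrow> finite (nbrs E v S)"
  by (simp add: nbrs_def)

definition ham_path :: "'a rel \<Rightarrow> 'a set \<Rightarrow> 'a \<Rightarrow> 'a \<Rightarrow> 'a list \<Rightarrow> bool" where
  "ham_path E R x y xs \<longleftrightarrow> distinct xs \<and> set xs = R \<and> xs \<noteq> [] \<and> hd xs = x \<and> last xs = y \<and>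
     successively (\<lambda>u v. (u, v) \<in> E) xs"

lemma successively_rev_sym:
  assumes "sym E"
  shows "successively (\<lambda>u v. (u, v) \<in> E) (rev xs) \<longleftrightarrow> successively (\<lambda>u v. (u, v) \<in> E) xs"
  unfolding successively_rev using assms by (intro successively_cong) (auto dest: symD)

section \<open>Rotations and the degree-sum closure\<close>

text \<open>Each endpoint of the new edge occurs only once in a list without repetition, so the edge
  is traversed at most once, in one of its two directions.\<close>

lemma successively_insert_arc:
  assumes "successively (\<lambda>a b. (a, b) \<in> E \<union> {(u, v), (v, u)}) xs" "distinct xs"
    and "\<not> successively (\<lambda>a b. (a, b) \<in> E) xs"
  obtains j where "Suc j < length xs" "{xs ! j, xs ! Suc j} = {u, v}"
    and "\<And>i. Suc i < length xs \<Longrightarrow> i \<noteq> j \<Longrightarrow> (xs ! i, xs ! Suc i) \<in> E"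
proof -
  from assms(3) obtain j where j: "Suc j < length xs" "(xs ! j, xs ! Suc j) \<notin> E"
    by (auto simp: successively_conv_nth)
  have step: "(xs ! i, xs ! Suc i) \<in> E \<or> {xs ! i, xs ! Suc i} = {u, v}" if "Suc i < length xs" for i
    using assms(1) that by (fastforce simp: successively_conv_nth)
  have uv: "{xs ! j, xs ! Suc j} = {u, v}"
    using step[OF j(1)] j(2) by blast
  have "(xs ! i, xs ! Suc i) \<in> E" if i: "Suc i < length xs" "i \<noteq> j" for i
  proof (rule ccontr)
    assume "\<not> ?thesis"
    then have "{xs ! i, xs ! Suc i} = {xs ! j, xs ! Suc j}"
      using step[OF i(1)] uv by simp
    then have "xs ! i = xs ! j \<or> xs ! i = xs ! Suc j \<and> xs ! Suc i = xs ! j"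
      by (auto simp: doubleton_eq_iff)
    then show False
      using assms(2) i j(1) by (auto simp: nth_eq_iff_index_eq)
  qed
  with that j(1) uv show ?thesis by blast
qed

text \<open>The segment between the two chords is reversed. This replaces the steps at
  \<open>j\<close> and \<open>k\<close> by the chords and keeps the ends, so the possibly missing
  step at \<open>j\<close> disappears.\<close>

lemma ham_path_rotate:
  assumes sym: "sym E" and xs: "distinct xs"
    and j: "Suc j < length xs"
    and E: "\<And>i. Suc i < length xs \<Longrightarrow> i \<noteq> j \<Longrightarrow> (xs ! i, xs ! Suc i) \<in> E"
    and k: "Suc k < length xs" "k \<noteq> j" "(xs ! j, xs ! k) \<in> E" "(xs ! Suc j, xs ! Suc k) \<in> E"
  shows "\<exists>ys. ham_path E (set xs) (hd xs) (last xs) ys"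
proof -
  let ?P = "\<lambda>u v. (u, v) \<in> E"
  \<comment> \<open>By symmetry of \<open>E\<close> the chords do not depend on which of
    \<open>j\<close> and \<open>k\<close> comes first, so both orders are treated at once.\<close>
  define a where "a = min j k"
  define b where "b = max j k"
  have ab: "a < b" "Suc b < length xs" using j k by (auto simp: a_def b_def)
  have e1: "(xs ! a, xs ! b) \<in> E" "(xs ! Suc a, xs ! Suc b) \<in> E"
    using k sym by (auto simp: a_def b_def min_def max_def dest: symD)
  define p where "p = take (Suc a) xs"
  define q where "q = take (b - a) (drop (Suc a) xs)"
  define r where "r = drop (Suc b) xs"
  have split: "xs = p @ q @ r"
  proof -
    have "drop (b - a) (drop (Suc a) xs) = r" using ab by (simp add: r_def)
    then show ?thesis unfolding p_def q_def by (metis append_take_drop_id)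
  qed
  have ne: "p \<noteq> []" "q \<noteq> []" "r \<noteq> []" using ab by (auto simp: p_def q_def r_def)
  have ends: "last p = xs ! a" "hd q = xs ! Suc a" "last q = xs ! b" "hd r = xs ! Suc b"
  proof -
    show "last p = xs ! a" using ab by (simp add: p_def take_Suc_conv_app_nth)
  qed (use ab in \<open>auto simp: q_def r_def last_conv_nth hd_drop_conv_nth hd_conv_nth\<close>)
  have lens: "length p = Suc a" "length q = b - a" using ab by (auto simp: p_def q_def)
  have lenr: "length r = length xs - Suc b" by (simp add: r_def)
  have nth: "i < length p \<Longrightarrow> p ! i = xs ! i" "i < length q \<Longrightarrow> q ! i = xs ! (Suc a + i)"
    "i < length r \<Longrightarrow> r ! i = xs ! (Suc b + i)" for i
    using ab by (auto simp: p_def q_def r_def)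
  \<comment> \<open>The step at \<open>j\<close> is one of the two cuts between \<open>p\<close>,
    \<open>q\<close> and \<open>r\<close>, so all steps inside the three pieces lie in
    \<open>E\<close>.\<close>
  have jab: "j = a \<or> j = b" by (auto simp: a_def b_def)
  have pP: "successively ?P p"
    unfolding successively_conv_nth using nth(1) E lens ab jab by auto
  have qP: "successively ?P q"
    unfolding successively_conv_nth using nth(2) E lens ab jab by auto
  have rP: "successively ?P r"
    unfolding successively_conv_nth using nth(3) E lenr ab jab by auto
  have "successively ?P (p @ rev q @ r)"
    using pP qP rP ne ends e1 sym
    by (auto simp: successively_append_iff successively_rev_sym hd_rev last_rev simp del: successively_rev)
  moreover have "distinct (p @ rev q @ r)" "set (p @ rev q @ r) = set xs"
    using xs by (auto simp: split)
  moreover have "hd (p @ rev q @ r) = hd xs" "last (p @ rev q @ r) = last xs"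
    using ne by (auto simp: split)
  ultimately have "ham_path E (set xs) (hd xs) (last xs) (p @ rev q @ r)"
    using ne by (simp add: ham_path_def)
  then show ?thesis ..
qed

text \<open>This is the Bondy-Chvatal step for prescribed ends. The degree sum must exceed
  \<open>card R\<close>, one more than for Hamiltonian cycles, because the last vertex starts no
  step and the first vertex ends none.\<close>

lemma ham_path_remove_arc:
  assumes sym: "sym E" and irr: "irrefl E"
    and ham: "ham_path (E \<union> {(u, v), (v, u)}) R x y xs"
    and deg: "card R < card (nbrs E u R) + card (nbrs E v R)"
  shows "\<exists>ys. ham_path E R x y ys"
proof (cases "ham_path E R x y xs")
  case True
  then show ?thesis ..
next
  case False
  have xs: "distinct xs" "set xs = R" "xs \<noteq> []" "hd xs = x" "last xs = y"
    "successively (\<lambda>a b. (a, b) \<in> E \<union> {(u, v), (v, u)}) xs"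
    using ham by (auto simp: ham_path_def)
  with False have "\<not> successively (\<lambda>a b. (a, b) \<in> E) xs"
    by (auto simp: ham_path_def)
  from successively_insert_arc[OF xs(6,1) this] obtain j where
    j: "Suc j < length xs" "{xs ! j, xs ! Suc j} = {u, v}"
    and E: "\<And>i. Suc i < length xs \<Longrightarrow> i \<noteq> j \<Longrightarrow> (xs ! i, xs ! Suc i) \<in> E"
    by blast
  \<comment> \<open>The names follow the order of traversal; the degree condition is symmetric in
    the two ends.\<close>
  define u' where "u' = xs ! j"
  define v' where "v' = xs ! Suc j"
  have deg': "card R < card (nbrs E u' R) + card (nbrs E v' R)"
    using deg j(2) by (auto simp: u'_def v'_def doubleton_eq_iff)
  define m where "m = length xs"
  have m: "card R = m" using xs by (metis distinct_card m_def)
  \<comment> \<open>\<open>K\<close> indexes the steps other than the new edge, \<open>m - 2\<close>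
    in number.\<close>
  define K where "K = {..<m - 1} - {j}"
  define A where "A = {k \<in> K. (u', xs ! k) \<in> E}"
  define B where "B = {k \<in> K. (v', xs ! Suc k) \<in> E}"
  have fin: "finite K" "finite A" "finite B" by (auto simp: K_def A_def B_def)
  have cK: "card K = m - 2" using j(1) by (simp add: K_def m_def)
  \<comment> \<open>Every neighbour of \<open>u'\<close> except possibly the last vertex starts a
    step in \<open>K\<close>; position \<open>j\<close> is \<open>u'\<close> itself and is ruled out
    because \<open>E\<close> has no loops.\<close>
  have "nbrs E u' R \<subseteq> insert (xs ! (m - 1)) ((!) xs ` A)"
  proof
    fix w assume "w \<in> nbrs E u' R"
    then obtain k where k: "k < m" "w = xs ! k" "(u', xs ! k) \<in> E"
      using xs(2) by (auto simp: nbrs_def in_set_conv_nth m_def)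
    then have "k \<noteq> j" using irr by (auto simp: u'_def irrefl_def)
    with k show "w \<in> insert (xs ! (m - 1)) ((!) xs ` A)"
      by (cases "k = m - 1") (auto simp: A_def K_def)
  qed
  then have "card (nbrs E u' R) \<le> card (insert (xs ! (m - 1)) ((!) xs ` A))"
    using fin by (intro card_mono) auto
  also have "\<dots> \<le> Suc (card ((!) xs ` A))" by (rule card_insert_le_m1) auto
  also have "\<dots> \<le> Suc (card A)" using fin by (simp add: card_image_le)
  finally have cA: "card (nbrs E u' R) \<le> Suc (card A)" .
  \<comment> \<open>Dually, every neighbour of \<open>v'\<close> except possibly the first vertex
    ends a step in \<open>K\<close>.\<close>
  have "nbrs E v' R \<subseteq> insert (xs ! 0) ((\<lambda>k. xs ! Suc k) ` B)"
  proof
    fix w assume "w \<in> nbrs E v' R"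
    then obtain k where k: "k < m" "w = xs ! k" "(v', xs ! k) \<in> E"
      using xs(2) by (auto simp: nbrs_def in_set_conv_nth m_def)
    then have "k \<noteq> Suc j" using irr by (auto simp: v'_def irrefl_def)
    with k show "w \<in> insert (xs ! 0) ((\<lambda>k. xs ! Suc k) ` B)"
      by (cases k) (auto simp: B_def K_def)
  qed
  then have "card (nbrs E v' R) \<le> card (insert (xs ! 0) ((\<lambda>k. xs ! Suc k) ` B))"
    using fin by (intro card_mono) auto
  also have "\<dots> \<le> Suc (card ((\<lambda>k. xs ! Suc k) ` B))" by (rule card_insert_le_m1) auto
  also have "\<dots> \<le> Suc (card B)" using fin by (simp add: card_image_le)
  finally have cB: "card (nbrs E v' R) \<le> Suc (card B)" .
  \<comment> \<open>Pigeonhole: the two sets have at least \<open>m + 1 - 2\<close> elements in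
    total, but \<open>K\<close> has only \<open>m - 2\<close>.\<close>
  have "A \<inter> B \<noteq> {}"
  proof
    assume "A \<inter> B = {}"
    then have "card A + card B = card (A \<union> B)" using fin by (simp add: card_Un_disjoint)
    also have "\<dots> \<le> card K" using fin by (intro card_mono) (auto simp: A_def B_def)
    finally show False using cA cB deg' cK m j(1) by (simp add: m_def)
  qed
  then obtain k where "k \<in> A" "k \<in> B" by blast
  then have "Suc k < length xs" "k \<noteq> j" "(xs ! j, xs ! k) \<in> E" "(xs ! Suc j, xs ! Suc k) \<in> E"
    by (auto simp: A_def B_def K_def m_def u'_def v'_def)
  from ham_path_rotate[OF sym xs(1) j(1) E this] show ?thesis
    using xs by auto
qed

lemma ham_path_complete:
  assumes "finite R" "x \<in> R" "y \<in> R" "x \<noteq> y"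
    and "\<And>u v. u \<in> R \<Longrightarrow> v \<in> R \<Longrightarrow> u \<noteq> v \<Longrightarrow> (u, v) \<in> E"
  shows "\<exists>xs. ham_path E R x y xs"
proof -
  obtain zs where zs: "set zs = R - {x, y}" "distinct zs"
    using assms(1) by (metis finite_Diff finite_distinct_list)
  have "ham_path E R x y (x # zs @ [y])"
    unfolding ham_path_def successively_conv_nth
  proof (intro conjI allI impI)
    show d: "distinct (x # zs @ [y])" using zs assms(4) by auto
    show s: "set (x # zs @ [y]) = R" using zs assms by auto
    fix i assume i: "Suc i < length (x # zs @ [y])"
    show "((x # zs @ [y]) ! i, (x # zs @ [y]) ! Suc i) \<in> E"
    proof (rule assms(5))
      show "(x # zs @ [y]) ! i \<in> R" "(x # zs @ [y]) ! Suc i \<in> R"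
        using i s nth_mem Suc_lessD by blast+
      show "(x # zs @ [y]) ! i \<noteq> (x # zs @ [y]) ! Suc i"
        using nth_eq_iff_index_eq[OF d, of i "Suc i"] i by simp
    qed
  qed auto
  then show ?thesis ..
qed

text \<open>A maximal relation between \<open>E\<close> and \<open>R \<times> R\<close> without the
  path must contain every pair of large degree sum, as adding such a pair cannot create the path.
  The hypothesis \<open>closed\<close> then makes it complete, where the path is obvious.\<close>

lemma ham_path_closure:
  assumes R: "finite R" "x \<in> R" "y \<in> R" "x \<noteq> y"
    and E: "sym E" "irrefl E" "E \<subseteq> R \<times> R"
    and closed: "\<And>F u v. sym F \<Longrightarrow> irrefl F \<Longrightarrow> E \<subseteq> F \<Longrightarrow> F \<subseteq> R \<times> R \<Longrightarrow>
      (\<And>a b. a \<in> R \<Longrightarrow> b \<in> R \<Longrightarrow> a \<noteq> b \<Longrightarrow> card R < card (nbrs F a R) + card (nbrs F b R) \<Longrightarrow>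
        (a, b) \<in> F) \<Longrightarrow>
      u \<in> R \<Longrightarrow> v \<in> R \<Longrightarrow> u \<noteq> v \<Longrightarrow> (u, v) \<in> F"
  shows "\<exists>xs. ham_path E R x y xs"
proof (rule ccontr)
  assume no: "\<not> ?thesis"
  define \<F> where "\<F> = {F. sym F \<and> irrefl F \<and> E \<subseteq> F \<and> F \<subseteq> R \<times> R \<and> (\<nexists>xs. ham_path F R x y xs)}"
  have "finite \<F>"
    by (rule finite_subset[of _ "Pow (R \<times> R)"]) (use R(1) in \<open>auto simp: \<F>_def\<close>)
  moreover have "E \<in> \<F>" using no E by (simp add: \<F>_def)
  ultimately obtain F where F: "F \<in> \<F>" and max: "\<And>F'. F' \<in> \<F> \<Longrightarrow> F \<subseteq> F' \<Longrightarrow> F = F'"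
    using finite_has_maximal[of \<F>] by blast
  have F': "sym F" "irrefl F" "E \<subseteq> F" "F \<subseteq> R \<times> R" "\<nexists>xs. ham_path F R x y xs"
    using F by (auto simp: \<F>_def)
  have "(a, b) \<in> F" if ab: "a \<in> R" "b \<in> R" "a \<noteq> b"
    and d: "card R < card (nbrs F a R) + card (nbrs F b R)" for a b
  proof (rule ccontr)
    assume nab: "(a, b) \<notin> F"
    let ?F = "F \<union> {(a, b), (b, a)}"
    have "\<nexists>xs. ham_path ?F R x y xs"
      using ham_path_remove_arc[OF F'(1,2) _ d] F'(5) by blast
    moreover have "sym ?F" "irrefl ?F"
      using F'(1,2) ab by (auto simp: sym_def irrefl_def)
    ultimately have "?F \<in> \<F>" using F' ab by (auto simp: \<F>_def)
    from max[OF this] nab show False by blast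
  qed
  then have "(u, v) \<in> F" if "u \<in> R" "v \<in> R" "u \<noteq> v" for u v
    using closed[OF F'(1-4)] that by blast
  from ham_path_complete[OF R this] F'(5) show False by blast
qed

text \<open>The closure fills up in three rounds. Good vertices become mutually adjacent and so have
  degree at least \<open>card R - card W - 1\<close>; with the summand 2 this joins them to every
  bad vertex; two bad vertices then have \<open>card R - card W\<close> neighbours each, enough
  because \<open>2 * card W < card R\<close>.\<close>

lemma ham_path_few_bad:
  assumes R: "finite R" "x \<in> R" "y \<in> R" "x \<noteq> y"
    and E: "sym E" "irrefl E"
    and W: "W \<subseteq> R" "2 * card W < card R"
    and good: "\<And>v. v \<in> R - W \<Longrightarrow> card R < 2 * card (nbrs E v R)"
    and bad: "\<And>v. v \<in> W \<Longrightarrow> card W + 2 \<le> card (nbrs E v R)"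
  shows "\<exists>xs. ham_path E R x y xs"
proof -
  \<comment> \<open>Cutting down to \<open>R\<close> leaves neighbourhoods within \<open>R\<close>
    unchanged and gives the closure argument a finite ambient set of pairs.\<close>
  define E' where "E' = E \<inter> R \<times> R"
  have nE': "nbrs E' v R = nbrs E v R" if "v \<in> R" for v
    using that by (auto simp: nbrs_def E'_def)
  have "\<exists>xs. ham_path E' R x y xs"
  proof (rule ham_path_closure[OF R])
    show "sym E'" "irrefl E'" "E' \<subseteq> R \<times> R"
      using E by (auto simp: E'_def sym_def irrefl_def)
    fix F u v
    assume F: "sym F" "irrefl F" "E' \<subseteq> F" "F \<subseteq> R \<times> R"
      and cl: "\<And>a b. a \<in> R \<Longrightarrow> b \<in> R \<Longrightarrow> a \<noteq> b \<Longrightarrow>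
        card R < card (nbrs F a R) + card (nbrs F b R) \<Longrightarrow> (a, b) \<in> F"
      and uv: "u \<in> R" "v \<in> R" "u \<noteq> v"
    have finW: "finite W" using W R finite_subset by blast
    have cRW: "card (R - W) = card R - card W" using W finW by (simp add: card_Diff_subset)
    have le: "card (nbrs E v R) \<le> card (nbrs F v R)" if "v \<in> R" for v
      using F(3) R(1) that by (intro card_mono) (auto simp: nbrs_def E'_def)
    have gg: "(a, b) \<in> F" if "a \<in> R - W" "b \<in> R - W" "a \<noteq> b" for a b
      using that le[of a] le[of b] good[of a] good[of b] by (intro cl) auto
    have dg: "card R - card W - 1 \<le> card (nbrs F a R)" if "a \<in> R - W" for a
    proof -
      have "card (R - W - {a}) \<le> card (nbrs F a R)"
        using gg that R(1) by (intro card_mono) (auto simp: nbrs_def)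
      then show ?thesis using that cRW R(1) by simp
    qed
    have gb: "(a, b) \<in> F" if "a \<in> W" "b \<in> R - W" for a b
    proof (rule cl)
      show "card R < card (nbrs F a R) + card (nbrs F b R)"
        using dg[OF that(2)] bad[OF that(1)] le[of a] that W by auto
    qed (use that W in auto)
    have db: "card R - card W \<le> card (nbrs F a R)" if "a \<in> W" for a
    proof -
      have "card (R - W) \<le> card (nbrs F a R)"
        using gb that R(1) by (intro card_mono) (auto simp: nbrs_def)
      then show ?thesis using cRW by simp
    qed
    have bb: "(a, b) \<in> F" if "a \<in> W" "b \<in> W" "a \<noteq> b" for a b
      using that db[of a] db[of b] W by (intro cl) auto
    show "(u, v) \<in> F"
      using gg gb bb uv F(1) by (meson DiffI symD)
  qed
  then obtain xs where xs: "ham_path E' R x y xs" ..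
  then have "successively (\<lambda>u v. (u, v) \<in> E) xs"
    by (auto simp: ham_path_def E'_def elim: successively_mono)
  with xs have "ham_path E R x y xs" by (simp add: ham_path_def)
  then show ?thesis ..
qed

section \<open>Halin graphs from connected dominating sets\<close>

text \<open>Restating the recursive walk condition with \<open>successively\<close> gives access to
  consecutive arcs by index.\<close>

lemma pcas_iff:
  "pcas u c v \<longleftrightarrow> (if c = [] then u = v else
     fst (hd c) = u \<and> snd (last c) = v \<and> successively (\<lambda>e f. snd e = fst f) c)"
proof (induction c arbitrary: u)
  case (Cons e c)
  show ?case
    unfolding pcas.simps Cons.IH by (cases c) auto
qed simp

lemma awalk_with_proj_iff:
  "pre_digraph.awalk (with_proj G) u c v \<longleftrightarrow> u \<in> pverts G \<and> set c \<subseteq> parcs G \<and> pcas u c v"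
  by (simp add: pre_digraph.awalk_def cas_with_proj_eq)

lemma tl_pawalk_verts: "pcas u c v \<Longrightarrow> tl (pawalk_verts u c) = map snd c"
proof -
  assume "pcas u c v"
  then have "pawalk_verts u c = u # map snd c"
    by (induction c arbitrary: u) auto
  then show ?thesis by simp
qed

lemma graph_cycle_iff:
  "graph_cycle G c \<longleftrightarrow> 3 \<le> length c \<and> fst (hd c) \<in> pverts G \<and> set c \<subseteq> parcs G \<and>
     distinct (map snd c) \<and> snd (last c) = fst (hd c) \<and> successively (\<lambda>e f. snd e = fst f) c"
  unfolding graph_cycle_def pre_digraph.cycle_def awalk_with_proj_iff awalk_verts_with_proj_eq
  by (auto simp: tl_pawalk_verts pcas_iff)

text \<open>The modulus covers the inner steps and the closing step from the last arc to the first
  alike.\<close>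

lemma graph_cycle_cyclic_nth:
  assumes "graph_cycle G c" "i < length c"
  shows "fst (c ! (Suc i mod length c)) = snd (c ! i)"
proof (cases "Suc i < length c")
  case True
  then show ?thesis
    using assms by (simp add: graph_cycle_iff successively_conv_nth)
next
  case False
  with assms have i: "Suc i = length c" by simp
  then have ne: "c \<noteq> []" by auto
  then have "last c = c ! i"
    using i last_conv_nth[OF ne] by (metis diff_Suc_1)
  moreover have "hd c = c ! 0" using ne by (rule hd_conv_nth)
  ultimately show ?thesis
    using assms(1) i by (simp add: graph_cycle_iff)
qed

lemma pair_graphI:
  assumes "finite (pverts G)" "parcs G \<subseteq> pverts G \<times> pverts G" "sym (parcs G)" "irrefl (parcs G)"
  shows "pair_graph G"
proof
  show "finite (parcs G)" using assms(1,2) by (meson finite_SigmaI finite_subset)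
  show "symmetric (with_proj G)" using assms(3) by (simp add: symmetric_def)
qed (use assms in \<open>auto simp: irrefl_def\<close>)

lemma out_degree_with_proj: "out_degree (with_proj G) v = card {u. (v, u) \<in> parcs G}"
proof -
  have "out_arcs (with_proj G) v = Pair v ` {u. (v, u) \<in> parcs G}"
    by (auto simp: out_arcs_def)
  then show ?thesis
    by (simp add: out_degree_def card_image inj_on_def)
qed

section \<open>Trees from parent functions\<close>

text \<open>A tree is stored as a parent function because a height that drops along \<open>p\<close>
  then certifies both connectedness and acyclicity.\<close>

definition parent_graph :: "'a set \<Rightarrow> 'a \<Rightarrow> ('a \<Rightarrow> 'a) \<Rightarrow> 'a pair_pre_digraph" where
  "parent_graph V r p = \<lparr>pverts = V,
     parcs = (\<lambda>v. (v, p v)) ` (V - {r}) \<union> (\<lambda>v. (p v, v)) ` (V - {r})\<rparr>"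

lemma parent_graph_simps [simp]:
  "pverts (parent_graph V r p) = V"
  "(u, v) \<in> parcs (parent_graph V r p) \<longleftrightarrow> u \<in> V - {r} \<and> v = p u \<or> v \<in> V - {r} \<and> u = p v"
  by (auto simp: parent_graph_def)

text \<open>Strict descent along \<open>p\<close> can only end at the root, which gives
  connectedness; acyclicity comes from the highest vertex of a supposed cycle.\<close>

lemma is_tree_parent_graph:
  fixes h :: "'a \<Rightarrow> nat"
  assumes V: "finite V" "r \<in> V"
    and p: "\<And>v. v \<in> V - {r} \<Longrightarrow> p v \<in> V \<and> h (p v) < h v"
  shows "is_tree (parent_graph V r p)"
proof -
  let ?T = "parent_graph V r p"
  have sym: "sym (parcs ?T)" by (auto simp: sym_def)
  have "pair_graph ?T"
  proof (rule pair_graphI)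
    have "p v \<noteq> v" if "v \<in> V - {r}" for v
      using p[OF that] by auto
    then show "irrefl (parcs ?T)" by (fastforce simp: irrefl_def)
    show "parcs ?T \<subseteq> pverts ?T \<times> pverts ?T" using p by (auto simp: parent_graph_def)
  qed (use V sym in auto)
  moreover have "connected (with_proj ?T)"
  proof -
    have S: "mk_symmetric (with_proj ?T) = ?T"
      using sym by (auto simp: mk_symmetric_def parent_graph_def)
    have reach: "(v, r) \<in> rtrancl_on V (parcs ?T)" if "v \<in> V" for v
      using that
    proof (induction v rule: measure_induct_rule[of h])
      case (less v)
      show ?case
      proof (cases "v = r")
        case False
        with less p[of v] have "(p v, r) \<in> rtrancl_on V (parcs ?T)" by simp
        then show ?thesis
          by (rule converse_rtrancl_on_into_rtrancl_on[rotated]) (use less False in auto)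
      qed (use V in auto)
    qed
    have "(u, v) \<in> rtrancl_on V (parcs ?T)" if "u \<in> V" "v \<in> V" for u v
      using reach[OF that(1)] reach[OF that(2)] rtrancl_on_sym[OF sym, of V]
      by (meson rtrancl_on_trans symD)
    then show ?thesis
      unfolding connected_def S strongly_connected_def reachable_def using V by auto
  qed
  moreover have "\<not> graph_cycle ?T c" for c
  proof
    \<comment> \<open>At a vertex of maximal height both neighbours on the cycle would be its parent.\<close>
    assume c: "graph_cycle ?T c"
    define k where "k = length c"
    have k: "3 \<le> k" "set c \<subseteq> parcs ?T" "distinct (map snd c)"
      using c by (auto simp: graph_cycle_iff k_def)
    obtain i where i: "i < k" and max: "\<And>j. j < k \<Longrightarrow> h (snd (c ! j)) \<le> h (snd (c ! i))"
    proof -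
      have "finite ((\<lambda>j. h (snd (c ! j))) ` {..<k})" "(\<lambda>j. h (snd (c ! j))) ` {..<k} \<noteq> {}"
        using k by (auto simp: lessThan_empty_iff)
      from Max_in[OF this] Max_ge[OF this(1)] that show ?thesis by fastforce
    qed
    \<comment> \<open>These are the cyclic predecessor and successor of \<open>i\<close>; length at
      least 3 makes them different.\<close>
    define j where "j = (if i = 0 then k - 1 else i - 1)"
    define l where "l = Suc i mod k"
    have jl: "j < k" "l < k" "Suc j mod k = i" "j \<noteq> l"
      using i k(1) by (auto simp: j_def l_def mod_Suc)
    have e: "c ! i \<in> parcs ?T" "c ! l \<in> parcs ?T"
      using k(2) i jl by (auto simp: k_def)
    have f: "fst (c ! i) = snd (c ! j)" "fst (c ! l) = snd (c ! i)"
      using graph_cycle_cyclic_nth[OF c, of j] graph_cycle_cyclic_nth[OF c, of i] i jl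
      by (auto simp: k_def l_def)
    \<comment> \<open>An edge joins a vertex to its strictly lower parent, so the end that is not
      higher is the parent.\<close>
    have par: "b = p a" if "(a, b) \<in> parcs ?T \<or> (b, a) \<in> parcs ?T" "h b \<le> h a" for a b
      using that p by fastforce
    have e': "(snd (c ! j), snd (c ! i)) \<in> parcs ?T" "(snd (c ! i), snd (c ! l)) \<in> parcs ?T"
      using e f by (metis prod.collapse)+
    have "snd (c ! j) = p (snd (c ! i))"
      using par e'(1) max[OF jl(1)] by blast
    moreover have "snd (c ! l) = p (snd (c ! i))"
      using par e'(2) max[OF jl(2)] by blast
    ultimately have "map snd c ! j = map snd c ! l" using jl by (simp add: k_def)
    with k(3) jl show False by (metis k_def length_map nth_eq_iff_index_eq)
  qed
  ultimately show ?thesis by (simp add: is_tree_def)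
qed

text \<open>Breadth-first search: \<open>h\<close> is the distance from \<open>r\<close> inside
  \<open>I\<close>, and the parent is the last vertex but one of a shortest walk.\<close>

lemma parent_function_of_connected:
  assumes "\<And>v. v \<in> I \<Longrightarrow> (r, v) \<in> (E \<inter> I \<times> I)\<^sup>*"
  obtains p and h :: "'a \<Rightarrow> nat"
  where "\<And>v. v \<in> I - {r} \<Longrightarrow> p v \<in> I \<and> (p v, v) \<in> E \<and> h (p v) < h v"
proof -
  define h where "h v = (LEAST k. (r, v) \<in> (E \<inter> I \<times> I) ^^ k)" for v
  have "\<exists>u. u \<in> I \<and> (u, v) \<in> E \<and> h u < h v" if v: "v \<in> I - {r}" for v
  proof -
    from assms v obtain k where "(r, v) \<in> (E \<inter> I \<times> I) ^^ k"
      by (metis DiffD1 rtrancl_imp_relpow)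
    then have hv: "(r, v) \<in> (E \<inter> I \<times> I) ^^ h v" unfolding h_def by (rule LeastI)
    with v obtain m where m: "h v = Suc m" by (cases "h v") auto
    with hv obtain u where u: "(r, u) \<in> (E \<inter> I \<times> I) ^^ m" "(u, v) \<in> E \<inter> I \<times> I"
      by (auto elim: relpow_Suc_E)
    have "h u \<le> m" unfolding h_def by (rule Least_le) (rule u)
    with u m show ?thesis by auto
  qed
  then obtain p where "\<forall>v \<in> I - {r}. p v \<in> I \<and> (p v, v) \<in> E \<and> h (p v) < h v"
    by metis
  with that show ?thesis by blast
qed

text \<open>Greedy choice: the sets already chosen occupy at most \<open>k * card F\<close>
  elements, and \<open>N x\<close> has at least \<open>k\<close> more.\<close>

lemma disjoint_choice:
  assumes "finite I" "\<And>i. i \<in> I \<Longrightarrow> finite (N i) \<and> k * card I \<le> card (N i)"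
  shows "\<exists>P. (\<forall>i\<in>I. P i \<subseteq> N i \<and> card (P i) = k) \<and> disjoint_family_on P I"
  using assms
proof (induction I rule: finite_induct)
  case (insert x F)
  have "\<exists>P. (\<forall>i\<in>F. P i \<subseteq> N i \<and> card (P i) = k) \<and> disjoint_family_on P F"
    by (rule insert.IH) (use insert.prems insert.hyps in fastforce)
  then obtain P where P: "\<And>i. i \<in> F \<Longrightarrow> P i \<subseteq> N i \<and> card (P i) = k"
    and dis: "disjoint_family_on P F" by blast
  define U where "U = (\<Union>i\<in>F. P i)"
  have "card U \<le> (\<Sum>i\<in>F. card (P i))" unfolding U_def by (rule card_UN_le) fact
  then have cU: "card U \<le> k * card F" using P by (simp add: mult.commute)
  have "finite U" unfolding U_def using insert P by (meson finite_UN finite_subset insertCI)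
  have "k \<le> card (N x) - card U"
    using insert.prems[of x] insert.hyps cU by (simp, linarith)
  also have "\<dots> \<le> card (N x - U)" by (rule diff_card_le_card_Diff) fact
  finally obtain Q where Q: "Q \<subseteq> N x - U" "card Q = k" "finite Q"
    by (rule obtain_subset_with_card_n)
  have "disjoint_family_on (P(x := Q)) (insert x F)"
    using dis Q(1) insert.hyps(2) by (fastforce simp: disjoint_family_on_def U_def)
  moreover have "\<forall>i\<in>insert x F. (P(x := Q)) i \<subseteq> N i \<and> card ((P(x := Q)) i) = k"
    using P Q by auto
  ultimately show ?case by blast
qed (simp add: disjoint_family_on_def)

section \<open>From a connected core to the Halin graph\<close>

lemma is_cycle_of_list:
  assumes xs: "distinct xs" "3 \<le> length xs"
    and E: "sym E" "irrefl E"
    and adj: "successively (\<lambda>u v. (u, v) \<in> E) xs" "(last xs, hd xs) \<in> E"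
  shows "\<exists>C. is_cycle C \<and> pverts C = set xs \<and> parcs C \<subseteq> E"
proof -
  define n where "n = length xs"
  \<comment> \<open>Pairing the list with its rotation yields all cyclic steps, including the
    closing one from the last entry to the first.\<close>
  define c where "c = zip xs (rotate1 xs)"
  define C where "C = \<lparr>pverts = set xs, parcs = set c \<union> (set c)\<inverse>\<rparr>"
  have n: "3 \<le> n" using xs by (simp add: n_def)
  have len: "length c = n" by (simp add: c_def n_def)
  have nth: "c ! i = (xs ! i, xs ! (Suc i mod n))" if "i < n" for i
    using that by (simp add: c_def n_def nth_rotate1)
  have cE: "set c \<subseteq> E"
  proof
    fix e assume "e \<in> set c"
    then obtain i where i: "i < n" "e = (xs ! i, xs ! (Suc i mod n))"
      using nth len by (auto simp: in_set_conv_nth)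
    show "e \<in> E"
    proof (cases "Suc i < n")
      case True
      with i adj(1) show ?thesis by (simp add: successively_conv_nth n_def)
    next
      case False
      with i have "Suc i = n" by simp
      moreover from this have "xs ! i = last xs"
        by (metis diff_Suc_1 last_conv_nth list.size(3) n_def nat.distinct(1))
      moreover have "xs ! 0 = hd xs" using n by (cases xs) (auto simp: n_def)
      ultimately show ?thesis using i adj(2) by simp
    qed
  qed
  have fs: "map fst c = xs" "map snd c = rotate1 xs" by (simp_all add: c_def)
  have fst_c: "fst ` set c = set xs"
    using fs(1) by (metis list.set_map)
  have set_cE: "set c \<subseteq> set xs \<times> set xs"
    unfolding c_def by (auto dest: set_zip_leftD set_zip_rightD)
  have "graph_cycle C c"
    unfolding graph_cycle_iff successively_conv_nth
  proof (intro conjI allI impI)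
    have ne: "c \<noteq> []" "xs \<noteq> []" using len n by (auto simp: n_def)
    show "fst (hd c) \<in> pverts C" using ne hd_map[OF ne(1), of fst] fs(1) hd_in_set[OF ne(2)] by (simp add: C_def)
    show "distinct (map snd c)" using xs by (simp add: fs)
    show "snd (last c) = fst (hd c)"
      using ne n len nth[of "n - 1"] nth[of 0] by (simp add: last_conv_nth hd_conv_nth)
    show "snd (c ! i) = fst (c ! Suc i)" if "Suc i < length c" for i
      using that len nth by simp
  qed (use n len in \<open>auto simp: C_def\<close>)
  moreover have "pair_graph C"
  proof (rule pair_graphI)
    show "irrefl (parcs C)" using E(2) cE by (auto simp: irrefl_def C_def)
    show "parcs C \<subseteq> pverts C \<times> pverts C"
      using set_cE by (auto simp: C_def)
    show "sym (parcs C)" by (auto simp: sym_def C_def)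
  qed (simp add: C_def)
  ultimately have "is_cycle C" using fst_c by (auto simp: is_cycle_def C_def)
  moreover have "parcs C \<subseteq> E" using cE E(1) by (auto simp: C_def dest: symD)
  ultimately show ?thesis by (intro exI[of _ C]) (simp add: C_def)
qed

lemma subgraph_with_projI:
  assumes "pair_graph H" "pair_graph G" "pverts H \<subseteq> pverts G" "parcs H \<subseteq> parcs G"
  shows "subgraph (with_proj H) (with_proj G)"
proof -
  interpret H: pair_graph H by fact
  interpret G: pair_graph G by fact
  show ?thesis
    using assms H.wf_digraph G.wf_digraph by (intro subgraphI) auto
qed

lemma pair_graph_Un:
  assumes "pair_graph G" "pair_graph H"
  shows "pair_graph \<lparr>pverts = pverts G \<union> pverts H, parcs = parcs G \<union> parcs H\<rparr>"
proof -
  interpret G: pair_graph G by fact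
  interpret H: pair_graph H by fact
  show ?thesis
    using G.pair_sym_arcs H.pair_sym_arcs
    by (intro pair_graphI)
      (auto simp: irrefl_def symmetric_def sym_def dest: G.in_arcsD1 G.in_arcsD2 H.in_arcsD1 H.in_arcsD2
        G.no_loops' H.no_loops')
qed

text \<open>\<open>I\<close> becomes the set of inner vertices. Reserving three private leaves for
  each of them rules out degrees 1 and 2, whereas a vertex outside \<open>I\<close> is attached by a
  single edge; \<open>xs\<close> closes up to the cycle on the leaves.\<close>

lemma generalized_Halin_of_core:
  fixes G :: "'a pair_pre_digraph"
  assumes G: "pair_graph G"
    and I: "I \<subseteq> pverts G" "r \<in> I" "\<And>v. v \<in> I \<Longrightarrow> (r, v) \<in> (parcs G \<inter> I \<times> I)\<^sup>*"
    and dom: "\<And>v. v \<in> pverts G - I \<Longrightarrow> \<exists>i\<in>I. (v, i) \<in> parcs G"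
    and deg: "\<And>i. i \<in> I \<Longrightarrow> 3 * card I \<le> card (nbrs (parcs G) i (pverts G - I))"
    and xs: "distinct xs" "3 \<le> length xs" "set xs = pverts G - I"
      "successively (\<lambda>u v. (u, v) \<in> parcs G) xs" "(last xs, hd xs) \<in> parcs G"
  shows "\<exists>H. spanning_generalized_Halin H G"
proof -
  interpret pair_graph G by fact
  let ?E = "parcs G" and ?V = "pverts G"
  have symE: "sym ?E" using pair_sym_arcs by (simp add: symmetric_def)
  have irrE: "irrefl ?E" by (meson irreflI no_loops')
  have finI: "finite I" using I(1) pair_finite_verts by (rule finite_subset)
  obtain p0 and h0 :: "'a \<Rightarrow> nat"
    where p0: "\<And>v. v \<in> I - {r} \<Longrightarrow> p0 v \<in> I \<and> (p0 v, v) \<in> ?E \<and> h0 (p0 v) < h0 v"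
    using parent_function_of_connected[OF I(3)] by metis
  obtain P where P: "\<And>i. i \<in> I \<Longrightarrow> P i \<subseteq> nbrs ?E i (?V - I) \<and> card (P i) = 3"
    and dis: "disjoint_family_on P I"
    using disjoint_choice[of I "\<lambda>i. nbrs ?E i (?V - I)" 3] finI deg by auto
  \<comment> \<open>A vertex reserved in some \<open>P j\<close> must hang on \<open>j\<close>,
    which is unique by disjointness; any other vertex hangs on an arbitrary neighbour in
    \<open>I\<close>.\<close>
  have "\<exists>i. i \<in> I \<and> (v, i) \<in> ?E \<and> (\<forall>j\<in>I. v \<in> P j \<longrightarrow> i = j)" if v: "v \<in> ?V - I" for v
  proof (cases "\<exists>j\<in>I. v \<in> P j")
    case True
    then obtain j where j: "j \<in> I" "v \<in> P j" by blast
    then have "(j, v) \<in> ?E" using P[of j] by (auto simp: nbrs_def)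
    then have "(v, j) \<in> ?E" using symE by (meson symD)
    moreover have "j = i" if "i \<in> I" "v \<in> P i" for i
      using dis j that by (meson disjoint_family_onD disjoint_iff)
    ultimately show ?thesis using j(1) by blast
  next
    case False
    with dom[OF v] show ?thesis by blast
  qed
  then have "\<forall>v \<in> ?V - I. \<exists>i. i \<in> I \<and> (v, i) \<in> ?E \<and> (\<forall>j\<in>I. v \<in> P j \<longrightarrow> i = j)"
    by blast
  from bchoice[OF this] obtain f where
    ff: "\<forall>v \<in> ?V - I. f v \<in> I \<and> (v, f v) \<in> ?E \<and> (\<forall>j\<in>I. v \<in> P j \<longrightarrow> f v = j)" ..
  then have f: "\<And>v. v \<in> ?V - I \<Longrightarrow> f v \<in> I \<and> (v, f v) \<in> ?E"
    and fP: "\<And>v j. v \<in> ?V - I \<Longrightarrow> j \<in> I \<Longrightarrow> v \<in> P j \<Longrightarrow> f v = j"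
    by blast+
  define p where "p v = (if v \<in> I then p0 v else f v)" for v
  \<comment> \<open>A vertex outside \<open>I\<close> gets one more than the height of its parent,
    so that \<open>h\<close> drops along \<open>p\<close> everywhere.\<close>
  define h where "h v = (if v \<in> I then h0 v else Suc (h0 (f v)))" for v
  define T where "T = parent_graph ?V r p"
  have pI: "p v \<in> I" if "v \<in> ?V - {r}" for v
    using that p0[of v] f[of v] by (simp add: p_def)
  have pE: "(v, p v) \<in> ?E" if "v \<in> ?V - {r}" for v
    using that p0[of v] f[of v] symD[OF symE, of "p0 v" v] by (cases "v \<in> I") (simp_all add: p_def)
  have tree: "is_tree T"
    unfolding T_def
  proof (rule is_tree_parent_graph[where h = h])
    fix v assume "v \<in> ?V - {r}"
    then show "p v \<in> ?V \<and> h (p v) < h v"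
      using p0[of v] f[of v] I(1) by (auto simp: p_def h_def)
  qed (use I(1,2) in auto)
  then have Tg: "pair_graph T" by (simp add: is_tree_def)
  have TE: "parcs T \<subseteq> ?E"
  proof
    fix e assume "e \<in> parcs T"
    then obtain v where v: "v \<in> ?V - {r}" "e = (v, p v) \<or> e = (p v, v)"
      by (auto simp: T_def parent_graph_def)
    then show "e \<in> ?E"
      using pE[OF v(1)] symD[OF symE pE[OF v(1)]] by auto
  qed
  have leaf: "out_degree (with_proj T) v = 1" if v: "v \<in> ?V - I" for v
  proof -
    have "{u. (v, u) \<in> parcs T} = {p v}"
    proof -
      \<comment> \<open>Parents always lie in \<open>I\<close>, so a vertex outside \<open>I\<close>
        has no children.\<close>
      have "p u \<noteq> v" if "u \<in> ?V - {r}" for u using pI[OF that] v by auto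
      then show ?thesis using v I(2) by (auto simp: T_def)
    qed
    then show ?thesis by (simp add: out_degree_with_proj)
  qed
  have inner: "3 \<le> out_degree (with_proj T) v" if v: "v \<in> I" for v
  proof -
    have "P v \<subseteq> {u. (v, u) \<in> parcs T}"
    proof
      fix u assume u: "u \<in> P v"
      then have "u \<in> ?V - I" using P[OF v] by (auto simp: nbrs_def)
      moreover from this have "p u = v" using fP[OF _ v u] by (simp add: p_def)
      ultimately show "u \<in> {u. (v, u) \<in> parcs T}" using I(2) by (auto simp: T_def)
    qed
    moreover have "finite {u. (v, u) \<in> parcs T}"
      by (rule finite_subset[of _ ?V]) (use TE in \<open>auto dest: in_arcsD2\<close>)
    ultimately have "card (P v) \<le> card {u. (v, u) \<in> parcs T}" by (intro card_mono)
    then show ?thesis using P[OF v] by (simp add: out_degree_with_proj)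
  qed
  have VT: "pverts T = ?V" by (simp add: T_def)
  have leaves: "leaves T = ?V - I"
  proof -
    have "v \<in> leaves T \<longleftrightarrow> v \<in> ?V - I" for v
      using leaf[of v] inner[of v] VT I(1) by (cases "v \<in> I") (auto simp: leaves_def)
    then show ?thesis by blast
  qed
  have "is_HIST T G"
    unfolding is_HIST_def spanning_def
  proof (intro conjI ballI)
    show "subgraph (with_proj T) (with_proj G)"
      using Tg G VT TE by (intro subgraph_with_projI) auto
    fix v assume "v \<in> pverts T"
    then show "out_degree (with_proj T) v \<noteq> 2"
      using leaf[of v] inner[of v] VT by (cases "v \<in> I") auto
  qed (use tree VT in auto)
  moreover obtain C where C: "is_cycle C" "pverts C = ?V - I" "parcs C \<subseteq> ?E"
    using is_cycle_of_list[OF xs(1,2) symE irrE xs(4,5)] xs(3) by auto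
  have Cg: "pair_graph C" using C by (simp add: is_cycle_def)
  have "subgraph (with_proj C) (with_proj G)"
    using Cg G C by (intro subgraph_with_projI) auto
  moreover define H where "H = \<lparr>pverts = pverts T \<union> pverts C, parcs = parcs T \<union> parcs C\<rparr>"
  have "with_proj H = union (with_proj T) (with_proj C)"
    by (simp add: H_def with_proj_def union_def)
  moreover have "spanning (with_proj H) (with_proj G)"
    unfolding spanning_def
  proof
    show "subgraph (with_proj H) (with_proj G)"
    proof (rule subgraph_with_projI)
      show "pair_graph H" unfolding H_def by (rule pair_graph_Un) fact+
    qed (use G TE C VT in \<open>auto simp: H_def\<close>)
  qed (use VT C in \<open>auto simp: H_def\<close>)
  ultimately have "spanning_generalized_Halin H G"
    unfolding spanning_generalized_Halin_def
    by (intro conjI exI[of _ T] exI[of _ C]) (use C leaves in simp_all)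
  then show ?thesis ..
qed

section \<open>Dominating sets and dense parts\<close>

text \<open>A matching in the style of Koenig: no two vertices meet all edges from \<open>A\<close>
  to \<open>B\<close>. Two independent edges are found directly; if a third is blocked by them,
  exchanging edges produces it after all.\<close>

lemma three_disjoint_edges:
  assumes conn: "\<And>p q. p \<in> A \<union> B \<Longrightarrow> q \<in> A \<union> B \<Longrightarrow>
    \<exists>a \<in> A - {p, q}. \<exists>b \<in> B - {p, q}. (a, b) \<in> E"
    and ne: "A \<union> B \<noteq> {}"
  obtains x1 x2 x3 y1 y2 y3
  where "distinct [x1, x2, x3]" "distinct [y1, y2, y3]" "{x1, x2, x3} \<subseteq> A" "{y1, y2, y3} \<subseteq> B"
    and "(x1, y1) \<in> E" "(x2, y2) \<in> E" "(x3, y3) \<in> E"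
proof (rule ccontr)
  define Q where "Q x y \<longleftrightarrow> x \<in> A \<and> y \<in> B \<and> (x, y) \<in> E" for x y
  assume "\<not> thesis"
  with that have no: False
    if "Q x y" "Q x' y'" "Q x'' y''" "x \<noteq> x'" "x \<noteq> x''" "x' \<noteq> x''" "y \<noteq> y'" "y \<noteq> y''" "y' \<noteq> y''"
    for x x' x'' y y' y''
    using that by (simp add: Q_def) blast
  have rem: "\<exists>a b. Q a b \<and> a \<noteq> p \<and> a \<noteq> q \<and> b \<noteq> p \<and> b \<noteq> q" if "p \<in> A \<union> B" "q \<in> A \<union> B" for p q
    using conn[OF that] by (auto simp: Q_def)
  \<comment> \<open>Here \<open>y1\<close> can be matched with \<open>a\<close> instead, which frees
    \<open>x1\<close>.\<close>
  have core: False
    if e: "Q x1 y1" "Q x2 y2" "Q a y1" "x1 \<noteq> x2" "y1 \<noteq> y2" "a \<noteq> x1" "a \<noteq> x2" for x1 x2 y1 y2 a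
  proof -
    \<comment> \<open>An edge avoiding \<open>y1\<close> and \<open>y2\<close> must start at
      \<open>x2\<close>, since any other start completes a matching of three.\<close>
    obtain x b where xb: "Q x b" "b \<noteq> y1" "b \<noteq> y2"
      using rem[of y1 y2] e(1,2) by (auto simp: Q_def)
    have "x \<noteq> x1" using no[of a y1 x1 b x2 y2] e xb by metis
    moreover have "x = x1 \<or> x = x2" using no[of x b x1 y1 x2 y2] e xb by metis
    ultimately have xb': "Q x2 b" using xb by simp
    \<comment> \<open>Both \<open>y1\<close> and \<open>x2\<close> have a spare edge, to
      \<open>a\<close> and to \<open>b\<close>, so an edge avoiding \<open>y1\<close> and
      \<open>x2\<close> completes a matching whatever its ends are.\<close>
    obtain p q where pq: "Q p q" "p \<noteq> x2" "q \<noteq> y1"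
      using rem[of y1 x2] e(1,2) by (auto simp: Q_def)
    show False
    proof (cases "p = x1")
      case True
      with pq have "Q x1 q" by simp
      then show False
        using no[of a y1 x1 y2 x2 b] no[of a y1 x1 q x2 y2] e xb xb' pq by metis
    next
      case False
      then show False
        using no[of p y2 x1 y1 x2 b] no[of p q x1 y1 x2 y2] e xb xb' pq by metis
    qed
  qed
  from ne obtain v where "v \<in> A \<union> B" by blast
  then obtain x1 y1 where e1: "Q x1 y1" using rem[of v v] by blast
  then obtain x2 y2 where e2: "Q x2 y2" "x2 \<noteq> x1" "y2 \<noteq> y1"
    using rem[of x1 y1] by (auto simp: Q_def)
  obtain a b where ab: "Q a b" "a \<noteq> x1" "a \<noteq> x2"
    using rem[of x1 x2] e1 e2 by (auto simp: Q_def)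
  then have "b = y1 \<or> b = y2" using no[of a b x1 y1 x2 y2] e1 e2 by metis
  then show False
    using core[of x1 y1 x2 y2 a] core[of x2 y2 x1 y1 a] e1 e2 ab by metis
qed

section \<open>Counting neighbours and dominating sets\<close>

lemma card_nbrs_sum: "finite S \<Longrightarrow> card (nbrs E v S) = (\<Sum>u\<in>S. if (v, u) \<in> E then 1 else 0)"
  by (simp add: nbrs_def sum.If_cases Int_def)

lemma sum_card_nbrs_swap:
  assumes "sym E" "finite S" "finite T"
  shows "(\<Sum>u\<in>S. card (nbrs E u T)) = (\<Sum>v\<in>T. card (nbrs E v S))"
proof -
  have "(\<Sum>u\<in>S. card (nbrs E u T)) = (\<Sum>u\<in>S. \<Sum>v\<in>T. if (u, v) \<in> E then 1 else 0)"
    using assms by (simp add: card_nbrs_sum)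
  also have "\<dots> = (\<Sum>v\<in>T. \<Sum>u\<in>S. if (u, v) \<in> E then 1 else 0)"
    by (rule sum.swap)
  also have "\<dots> = (\<Sum>v\<in>T. \<Sum>u\<in>S. if (v, u) \<in> E then 1 else 0)"
    using assms(1) by (intro sum.cong refl if_cong) (auto intro: symD)
  also have "\<dots> = (\<Sum>v\<in>T. card (nbrs E v S))"
    using assms by (simp add: card_nbrs_sum)
  finally show ?thesis .
qed

lemma card_nbrs_Un_le:
  assumes "finite S" "finite T"
  shows "card (nbrs E v (S \<union> T)) \<le> card (nbrs E v S) + card (nbrs E v T)"
proof -
  have "nbrs E v (S \<union> T) = nbrs E v S \<union> nbrs E v T" by (auto simp: nbrs_def)
  then show ?thesis by (simp add: card_Un_le)
qed

lemma card_nbrs_mono: "finite T \<Longrightarrow> S \<subseteq> T \<Longrightarrow> card (nbrs E v S) \<le> card (nbrs E v T)"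
  by (rule card_mono) (auto simp: nbrs_def)

lemma card_nbrs_Diff_ge:
  assumes "finite S" "finite X"
  shows "card (nbrs E v S) \<le> card (nbrs E v (S - X)) + card X"
proof -
  have "card (nbrs E v S) \<le> card (nbrs E v ((S - X) \<union> X))"
    by (rule card_nbrs_mono) (use assms in auto)
  also have "\<dots> \<le> card (nbrs E v (S - X)) + card (nbrs E v X)"
    by (rule card_nbrs_Un_le) (use assms in auto)
  also have "card (nbrs E v X) \<le> card X"
    using assms by (intro card_mono nbrs_subset)
  finally show ?thesis by simp
qed

text \<open>\<open>D0\<close> is a maximal set whose vertices dominate \<open>s\<close> vertices each on average; then no vertex
  sees \<open>s\<close> of the undominated ones, so double counting shows that those are few.\<close>

lemma dominating_set:
  assumes V: "finite V" and sym: "sym E" and s: "0 < s" and c: "0 < c"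
    and X: "finite X"
    and deg: "\<And>v. v \<in> V \<Longrightarrow> c + card X \<le> card (nbrs E v V)"
  obtains D0 D1 where "D0 \<subseteq> V - X" "D1 \<subseteq> V - X"
    and "\<And>v. v \<in> V \<Longrightarrow> \<exists>d\<in>D0 \<union> D1. (v, d) \<in> E"
    and "s * card D0 \<le> card V" "c * card D1 \<le> s * card V"
proof -
  define dm where "dm D = {v \<in> V. \<exists>d\<in>D. (v, d) \<in> E}" for D
  define \<D> where "\<D> = {D. D \<subseteq> V - X \<and> s * card D \<le> card (dm D)}"
  have "finite \<D>" by (rule finite_subset[of _ "Pow V"]) (use V in \<open>auto simp: \<D>_def\<close>)
  moreover have "{} \<in> \<D>" by (simp add: \<D>_def)
  ultimately obtain D0 where D0: "D0 \<in> \<D>" and max: "\<And>D. D \<in> \<D> \<Longrightarrow> D0 \<subseteq> D \<Longrightarrow> D0 = D"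
    using finite_has_maximal[of \<D>] by blast
  have D0': "D0 \<subseteq> V - X" "s * card D0 \<le> card (dm D0)" using D0 by (auto simp: \<D>_def)
  have finD0: "finite D0" using D0' V finite_subset by blast
  define U where "U = V - dm D0"
  have UV: "U \<subseteq> V" "finite U" using V by (auto simp: U_def)
  have few: "card (nbrs E w U) \<le> s" if w: "w \<in> V - X" for w
  proof (cases "w \<in> D0")
    case True
    have "(w, u) \<notin> E" if "u \<in> U" for u
      using that True symD[OF sym, of w u] by (auto simp: U_def dm_def)
    then have "nbrs E w U = {}" by (auto simp: nbrs_def)
    then show ?thesis by simp
  next
    case False
    \<comment> \<open>Maximality: a vertex dominating \<open>s\<close> new vertices could be added
      to \<open>D0\<close>.\<close>
    then have "insert w D0 \<notin> \<D>" using max by blast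
    then have lt: "card (dm (insert w D0)) < s * card (insert w D0)"
      using w D0' by (auto simp: \<D>_def)
    have "dm D0 \<union> nbrs E w U \<subseteq> dm (insert w D0)"
      using symD[OF sym] UV by (auto simp: dm_def nbrs_def)
    then have "card (dm D0 \<union> nbrs E w U) \<le> card (dm (insert w D0))"
      using V by (intro card_mono) (auto simp: dm_def)
    moreover have "card (dm D0 \<union> nbrs E w U) = card (dm D0) + card (nbrs E w U)"
      using V UV by (intro card_Un_disjoint) (auto simp: dm_def nbrs_def U_def)
    ultimately show ?thesis
      using lt D0'(2) False finD0 by simp
  qed
  have degX: "c \<le> card (nbrs E u (V - X))" if "u \<in> V" for u
    using deg[OF that] card_nbrs_Diff_ge[OF V X, of E u] by linarith
  \<comment> \<open>Pairs between \<open>U\<close> and \<open>V - X\<close> are counted from both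
    sides: at least \<open>c\<close> for each vertex of \<open>U\<close>, at most \<open>s\<close>
    for each vertex of \<open>V - X\<close>.\<close>
  have "card U * c \<le> (\<Sum>u\<in>U. card (nbrs E u (V - X)))"
    using sum_bounded_below[of U c "\<lambda>u. card (nbrs E u (V - X))"] degX UV(1) by (simp add: subset_iff)
  also have "\<dots> = (\<Sum>w\<in>V - X. card (nbrs E w U))"
    using sum_card_nbrs_swap[OF sym] V UV by simp
  also have "\<dots> \<le> card (V - X) * s"
    using sum_bounded_above[of "V - X" "\<lambda>w. card (nbrs E w U)" s] few by simp
  also have "\<dots> \<le> card V * s"
    using V by (simp add: card_mono)
  finally have cU: "card U * c \<le> card V * s" .
  \<comment> \<open>One neighbour outside \<open>X\<close> is picked for each vertex of
    \<open>U\<close>; these form \<open>D1\<close>.\<close>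
  have "\<exists>w \<in> V - X. (u, w) \<in> E" if "u \<in> U" for u
  proof -
    have "u \<in> V" using that UV by blast
    then have "nbrs E u (V - X) \<noteq> {}" using degX[of u] c by force
    then show ?thesis by (auto simp: nbrs_def)
  qed
  then obtain f where f: "\<forall>u\<in>U. f u \<in> V - X \<and> (u, f u) \<in> E" by metis
  show thesis
  proof (rule that[of D0 "f ` U"])
    show "D0 \<subseteq> V - X" by (rule D0'(1))
    show "f ` U \<subseteq> V - X" using f by blast
    show "\<exists>d\<in>D0 \<union> f ` U. (v, d) \<in> E" if "v \<in> V" for v
      using that f by (cases "v \<in> U") (auto simp: U_def dm_def)
    have "card (dm D0) \<le> card V" using V by (intro card_mono) (auto simp: dm_def)
    then show "s * card D0 \<le> card V" using D0'(2) by linarith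
    have "c * card (f ` U) \<le> c * card U"
      using card_image_le[OF UV(2)] by (rule mult_le_mono2)
    then show "c * card (f ` U) \<le> s * card V" using cU by (metis le_trans mult.commute)
  qed
qed

text \<open>Each vertex of \<open>D\<close> brings itself and the two inner vertices of a walk of
  length three to \<open>g\<close>; with the hub this gives the size bound.\<close>

lemma connect_to_hub:
  assumes "finite D" "D \<subseteq> S" "g \<in> S" "sym E"
    and path: "\<And>d. d \<in> D \<Longrightarrow> \<exists>a\<in>S. \<exists>b\<in>S. (d, a) \<in> E \<and> (a, b) \<in> E \<and> (b, g) \<in> E"
  obtains J where "D \<subseteq> J" "J \<subseteq> S" "g \<in> J" "finite J" "card J \<le> 3 * card D + 1"
    and "\<And>v. v \<in> J \<Longrightarrow> (g, v) \<in> (E \<inter> J \<times> J)\<^sup>*"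
proof -
  have "\<forall>d\<in>D. \<exists>ab. fst ab \<in> S \<and> snd ab \<in> S \<and> (d, fst ab) \<in> E \<and> (fst ab, snd ab) \<in> E \<and> (snd ab, g) \<in> E"
    using path by fastforce
  from bchoice[OF this] obtain f where
    f: "\<forall>d\<in>D. fst (f d) \<in> S \<and> snd (f d) \<in> S \<and> (d, fst (f d)) \<in> E \<and> (fst (f d), snd (f d)) \<in> E \<and>
      (snd (f d), g) \<in> E" ..
  define a where "a d = fst (f d)" for d
  define b where "b d = snd (f d)" for d
  have ab: "a d \<in> S" "b d \<in> S" "(a d, d) \<in> E" "(b d, a d) \<in> E" "(g, b d) \<in> E" if "d \<in> D" for d
    using f that symD[OF assms(4)] by (auto simp: a_def b_def)
  define J where "J = insert g (D \<union> a ` D \<union> b ` D)"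
  have fin: "finite J" using assms(1) by (simp add: J_def)
  have "card J \<le> Suc (card (D \<union> a ` D \<union> b ` D))"
    unfolding J_def by (rule card_insert_le_m1) auto
  also have "card (D \<union> a ` D \<union> b ` D) \<le> card D + card (a ` D) + card (b ` D)"
    by (meson add_mono card_Un_le le_trans order_refl)
  also have "\<dots> \<le> 3 * card D"
    using card_image_le[OF assms(1), of a] card_image_le[OF assms(1), of b] by linarith
  finally have card: "card J \<le> 3 * card D + 1" by simp
  define F where "F = E \<inter> J \<times> J"
  have reach: "(g, b d) \<in> F\<^sup>*" "(g, a d) \<in> F\<^sup>*" "(g, d) \<in> F\<^sup>*" if d: "d \<in> D" for d
  proof -
    have e: "(g, b d) \<in> F" "(b d, a d) \<in> F" "(a d, d) \<in> F"
      using ab[OF d] d by (simp_all add: F_def J_def)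
    show "(g, b d) \<in> F\<^sup>*" using e(1) by (rule r_into_rtrancl)
    then show "(g, a d) \<in> F\<^sup>*" using e(2) by (rule rtrancl_into_rtrancl)
    then show "(g, d) \<in> F\<^sup>*" using e(3) by (rule rtrancl_into_rtrancl)
  qed
  show thesis
  proof (rule that[OF _ _ _ fin card])
    show "D \<subseteq> J" "g \<in> J" by (auto simp: J_def)
    show "J \<subseteq> S" using assms(2,3) ab(1,2) by (auto simp: J_def)
    fix v assume "v \<in> J"
    then consider "v = g" | d where "d \<in> D" "v = d \<or> v = a d \<or> v = b d"
      by (auto simp: J_def)
    then have "(g, v) \<in> F\<^sup>*"
      using reach by cases auto
    then show "(g, v) \<in> (E \<inter> J \<times> J)\<^sup>*" by (simp add: F_def)
  qed
qed

lemma common_nbr: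
  assumes "finite S" "card S < card (nbrs E u S) + card (nbrs E v S)"
  shows "\<exists>w\<in>S. (u, w) \<in> E \<and> (v, w) \<in> E"
proof (rule ccontr)
  assume "\<not> ?thesis"
  then have "nbrs E u S \<inter> nbrs E v S = {}" by (auto simp: nbrs_def)
  then have "card (nbrs E u S) + card (nbrs E v S) = card (nbrs E u S \<union> nbrs E v S)"
    using assms(1) by (simp add: card_Un_disjoint)
  also have "\<dots> \<le> card S" using assms(1) by (intro card_mono) (auto simp: nbrs_def)
  finally show False using assms(2) by simp
qed

text \<open>Here \<open>W\<close> is the small set of exceptional vertices of a part \<open>S\<close>.\<close>

definition dense_part :: "'a rel \<Rightarrow> nat \<Rightarrow> 'a set \<Rightarrow> 'a set \<Rightarrow> bool" where
  "dense_part E n S W \<longleftrightarrow> finite S \<and> W \<subseteq> S \<and>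
     38 / 100 * real n \<le> real (card S) \<and> real (card S) \<le> 62 / 100 * real n \<and>
     real (card W) \<le> real n / 1000 \<and>
     (\<forall>v \<in> S - W. 38 / 100 * real n \<le> real (card (nbrs E v S))) \<and>
     (\<forall>v \<in> W. real n / 100 \<le> real (card (nbrs E v S)))"

section \<open>Connecting and traversing a dense part\<close>

text \<open>The hub is any vertex outside \<open>W\<close> and \<open>X\<close>. An element of
  \<open>D\<close> has at least \<open>n / 100\<close> neighbours in \<open>S\<close>, more than
  \<open>W\<close> and \<open>X\<close> can absorb, hence one outside both. That neighbour and the
  hub have degrees adding up to at least \<open>76 / 100 * n\<close> in a part of size at most
  \<open>62 / 100 * n\<close>, so they share a neighbour outside \<open>X\<close>.\<close>

lemma dense_part_connect:
  assumes part: "dense_part E n S W" and E: "sym E" and n: "1000 \<le> n"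
    and X: "finite X" "card X \<le> 4" and D: "D \<subseteq> S - X"
  obtains J g where "D \<subseteq> J" "J \<subseteq> S - X" "g \<in> J" "finite J" "card J \<le> 3 * card D + 1"
    and "\<And>v. v \<in> J \<Longrightarrow> (g, v) \<in> (E \<inter> J \<times> J)\<^sup>*"
proof -
  have S: "finite S" "W \<subseteq> S" "38 / 100 * real n \<le> real (card S)"
      "real (card S) \<le> 62 / 100 * real n" "real (card W) \<le> real n / 1000"
    and good: "\<And>v. v \<in> S - W \<Longrightarrow> 38 / 100 * real n \<le> real (card (nbrs E v S))"
    and bad: "\<And>v. v \<in> W \<Longrightarrow> real n / 100 \<le> real (card (nbrs E v S))"
    using part by (auto simp: dense_part_def)
  have finW: "finite W" using S finite_subset by blast
  have n': "1000 \<le> real n" "real (card X) \<le> 4" using n X by auto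
  have WX: "card (W \<union> X) \<le> card W + card X" by (rule card_Un_le)
  have finWX: "finite (W \<union> X)" using finW X by simp
  have "card (W \<union> X) < card S" using S(3,5) n' WX by linarith
  then have "\<not> S \<subseteq> W \<union> X" using card_mono[OF finWX] by (meson linorder_not_less)
  then obtain g where g: "g \<in> S - (W \<union> X)" by blast
  have path: "\<exists>a\<in>S - X. \<exists>b\<in>S - X. (d, a) \<in> E \<and> (a, b) \<in> E \<and> (b, g) \<in> E" if "d \<in> D" for d
  proof -
    have dS: "d \<in> S" using that D by blast
    have "real n / 100 \<le> real (card (nbrs E d S))"
      using good[of d] bad[of d] dS by (cases "d \<in> W") auto
    then have "0 < card (nbrs E d (S - (W \<union> X)))"
      using card_nbrs_Diff_ge[OF S(1) finWX, of E d] WX S(5) n' by linarith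
    then obtain a where a: "a \<in> S - (W \<union> X)" "(d, a) \<in> E"
      by (auto simp: nbrs_def card_gt_0_iff)
    have "card (S - X) < card (nbrs E a (S - X)) + card (nbrs E g (S - X))"
    proof -
      have "card (S - X) \<le> card S" using S(1) by (intro card_mono) auto
      then show ?thesis
        using card_nbrs_Diff_ge[OF S(1) X(1), of E a] card_nbrs_Diff_ge[OF S(1) X(1), of E g]
          good[of a] good[of g] a g S(4) n' by auto
    qed
    from common_nbr[OF _ this] obtain b where "b \<in> S - X" "(a, b) \<in> E" "(g, b) \<in> E"
      using S(1) by auto
    then show ?thesis using a symD[OF E] by blast
  qed
  have finD: "finite D" by (meson D S(1) finite_Diff finite_subset)
  have gX: "g \<in> S - X" using g by blast
  show thesis
    by (rule connect_to_hub[OF finD D gX E], erule path, rule that)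
qed

text \<open>Deleting \<open>I\<close> costs each vertex at most \<open>n / 1000\<close> neighbours.
  Good vertices keep at least \<open>379 / 1000 * n\<close>, more than half of
  \<open>62 / 100 * n\<close>, and exceptional ones keep \<open>9 / 1000 * n\<close>, more than
  \<open>card W + 2\<close>.\<close>

lemma dense_part_ham_path:
  assumes part: "dense_part E n S W" and E: "sym E" "irrefl E" and n: "1000 \<le> n"
    and I: "finite I" "real (card I) \<le> real n / 1000"
    and xy: "x \<in> S - I" "y \<in> S - I" "x \<noteq> y"
  shows "\<exists>xs. ham_path E (S - I) x y xs"
proof -
  have S: "finite S" "W \<subseteq> S" "38 / 100 * real n \<le> real (card S)"
      "real (card S) \<le> 62 / 100 * real n" "real (card W) \<le> real n / 1000"
    and good: "\<And>v. v \<in> S - W \<Longrightarrow> 38 / 100 * real n \<le> real (card (nbrs E v S))"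
    and bad: "\<And>v. v \<in> W \<Longrightarrow> real n / 100 \<le> real (card (nbrs E v S))"
    using part by (auto simp: dense_part_def)
  have finW: "finite W" using S finite_subset by blast
  have n': "1000 \<le> real n" using n by simp
  have cR: "card (S - I) \<le> card S" "card S \<le> card (S - I) + card I"
    using S(1) I(1) diff_card_le_card_Diff[OF I(1), of S] by (auto intro: card_mono)
  have cW: "card (W - I) \<le> card W" using finW by (intro card_mono) auto
  have d: "card (nbrs E v S) \<le> card (nbrs E v (S - I)) + card I" for v
    by (rule card_nbrs_Diff_ge) fact+
  show ?thesis
  proof (rule ham_path_few_bad[where W = "W - I"])
    show "2 * card (W - I) < card (S - I)"
      using S(3,5) I(2) n' cR cW by linarith
    show "card (S - I) < 2 * card (nbrs E v (S - I))" if "v \<in> S - I - (W - I)" for v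
      using good[of v] that d[of v] cR S(4) I(2) n' by auto
    show "card (W - I) + 2 \<le> card (nbrs E v (S - I))" if "v \<in> W - I" for v
      using bad[of v] that d[of v] cW S(5) I(2) n' by auto
  qed (use S E xy in auto)
qed

text \<open>Without a crossing edge everything reachable from \<open>P\<close> stays in
  \<open>P\<close>; symmetrizing adds no arcs because \<open>G\<close> is already symmetric.\<close>

lemma connected_crossing_edge:
  assumes "pair_graph G" "connected (with_proj G \<restriction> R)" "R = P \<union> Q" "P \<inter> Q = {}"
    and "P \<noteq> {}" "Q \<noteq> {}"
  shows "\<exists>a\<in>P. \<exists>b\<in>Q. (a, b) \<in> parcs G"
proof (rule ccontr)
  assume no: "\<not> ?thesis"
  interpret pair_graph G by fact
  let ?M = "mk_symmetric (with_proj G \<restriction> R)"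
  have M: "verts ?M = R" "(u, v) \<in> arcs ?M \<Longrightarrow> (u, v) \<in> parcs G" for u v
    using arcs_symmetric by (auto simp: mk_symmetric_def)
  obtain a b where ab: "a \<in> P" "b \<in> Q" using assms by blast
  then have "(a, b) \<in> rtrancl_on R (parcs ?M)"
    using assms(2,3) M(1) unfolding connected_def strongly_connected_def reachable_def by auto
  then have "b \<in> P"
  proof (induction rule: rtrancl_on_induct)
    case (step y z)
    then show ?case using no M(2)[of y z] assms(3) by auto
  qed (use ab in auto)
  with ab assms(4) show False by blast
qed

section \<open>The extremal case\<close>

text \<open>The deleted set is smaller than either part, so both parts survive and connectedness
  forces an edge between them.\<close>

lemma k_connected_crossing_edge:
  assumes G: "pair_graph G" and conn: "k_connected k G"
    and part: "A \<union> B = pverts G" "A \<inter> B = {}"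
    and S: "S \<subseteq> pverts G" "card S < k" "card S < card A" "card S < card B"
  shows "\<exists>a \<in> A - S. \<exists>b \<in> B - S. (a, b) \<in> parcs G"
proof (rule connected_crossing_edge[OF G])
  interpret pair_graph G by fact
  have fin: "finite S" using S(1) pair_finite_verts by (rule finite_subset)
  show "connected (with_proj G \<restriction> (pverts G - S))"
    using conn S(1,2) by (simp add: k_connected_def)
  show "A - S \<noteq> {}" "B - S \<noteq> {}"
    using card_mono[OF fin, of A] card_mono[OF fin, of B] S(3,4) by (auto simp: Diff_eq_empty_iff)
qed (use part in auto)

text \<open>The parts enter symmetrically, each with its own exceptional set, and 3-connectivity
  supplies the edges joining them.\<close>

lemma generalized_Halin_of_dense_parts:
  fixes G :: "'a pair_pre_digraph"
  assumes G: "pair_graph G" and conn: "k_connected 3 G"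
    and n: "card (pverts G) = n" "10 ^ 9 \<le> n"
    and part: "A \<union> B = pverts G" "A \<inter> B = {}"
    and A: "dense_part (parcs G) n A W" and B: "dense_part (parcs G) n B W'"
    and deg: "\<And>v. v \<in> pverts G \<Longrightarrow> 39 / 100 * real n \<le> real (card (nbrs (parcs G) v (pverts G)))"
  shows "\<exists>H. spanning_generalized_Halin H G"
proof -
  interpret pair_graph G by fact
  let ?E = "parcs G" and ?V = "pverts G"
  have symE: "sym ?E" using pair_sym_arcs by (simp add: symmetric_def)
  have irrE: "irrefl ?E" by (meson irreflI no_loops')
  have finV: "finite ?V" by (rule pair_finite_verts)
  have n': "1000000000 \<le> real n" using n(2) by simp
  have n1000: "1000 \<le> n" using n(2) by simp
  have cAB: "2 < card A" "2 < card B"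
    using A B n' by (auto simp: dense_part_def)
  have rem: "\<exists>a \<in> A - {p, q}. \<exists>b \<in> B - {p, q}. (a, b) \<in> ?E" if "p \<in> A \<union> B" "q \<in> A \<union> B" for p q
  proof (rule k_connected_crossing_edge[OF G conn part])
    have "card {p, q} \<le> 2" by (simp add: card_insert_if)
    then show "card {p, q} < 3" "card {p, q} < card A" "card {p, q} < card B"
      using cAB by linarith+
  qed (use that part in auto)
  have "A \<union> B \<noteq> {}" using cAB by auto
  from three_disjoint_edges[of A B ?E, OF rem this] obtain x1 x2 x3 y1 y2 y3
    where xy: "distinct [x1, x2, x3]" "distinct [y1, y2, y3]" "{x1, x2, x3} \<subseteq> A" "{y1, y2, y3} \<subseteq> B"
    and e: "(x1, y1) \<in> ?E" "(x2, y2) \<in> ?E" "(x3, y3) \<in> ?E"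
    by blast
  \<comment> \<open>These are the ends of the two future Hamiltonian paths, which must stay outside
    \<open>I\<close>.\<close>
  define X where "X = {x1, x2, y1, y2}"
  have X: "finite X" "card X \<le> 4" "X \<subseteq> ?V"
    using xy part by (auto simp: X_def card_insert_if)
  have x3: "x3 \<in> A - X" "y3 \<in> B - X" using xy part by (auto simp: X_def)
  \<comment> \<open>\<open>c\<close> lies between \<open>n / 4\<close> and \<open>n / 3\<close>:
    small enough for the degree bound with \<open>X\<close> removed, large enough for a constant
    bound on \<open>card D1\<close>.\<close>
  define c where "c = n div 3"
  have c: "0 < c" "n \<le> 4 * c" using n1000 by (auto simp: c_def)
  have "c + card X \<le> card (nbrs ?E v ?V)" if "v \<in> ?V" for v
  proof -
    have "3 * real c \<le> real n" unfolding c_def by linarith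
    moreover have "real (card X) \<le> 4" using X(2) by simp
    ultimately have "real (c + card X) \<le> real (card (nbrs ?E v ?V))"
      using deg[OF that] n' by simp
    then show ?thesis by linarith
  qed
  \<comment> \<open>With \<open>s = 10000\<close> the first set has at most \<open>n / 10000\<close>
    vertices and the second at most 40000, so their total stays below \<open>n / 1000\<close> even
    after the tripling caused by the hubs.\<close>
  from dominating_set[OF finV symE _ c(1) X(1) this, of 10000] obtain D0 D1 where
    D: "D0 \<subseteq> ?V - X" "D1 \<subseteq> ?V - X" and dom: "\<And>v. v \<in> ?V \<Longrightarrow> \<exists>d\<in>D0 \<union> D1. (v, d) \<in> ?E"
    and cD: "10000 * card D0 \<le> card ?V" "c * card D1 \<le> 10000 * card ?V"
    by auto
  have "c * card D1 \<le> c * 40000"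
    using cD(2) c(2) n(1) by linarith
  then have cD1: "card D1 \<le> 40000" using c(1) by simp
  define D where "D = D0 \<union> D1"
  have cardD: "card D \<le> card D0 + card D1" unfolding D_def by (rule card_Un_le)
  have DV: "D \<subseteq> ?V - X" using D by (auto simp: D_def)
  have finD: "finite D" using DV finV by (meson finite_Diff finite_subset)
  have cDAB: "card (D \<inter> A) + card (D \<inter> B) \<le> card D"
  proof -
    have "card (D \<inter> A) + card (D \<inter> B) = card (D \<inter> A \<union> D \<inter> B)"
      using finD part by (intro card_Un_disjoint[symmetric]) auto
    also have "\<dots> \<le> card D" using finD by (intro card_mono) auto
    finally show ?thesis .
  qed
  \<comment> \<open>Including \<open>x3\<close>, and below \<open>y3\<close>, lets the third edge
    join the two connected sets.\<close>
  have "insert x3 (D \<inter> A) \<subseteq> A - X" using x3 DV by auto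
  from dense_part_connect[OF A symE n1000 X(1,2) this] obtain JA gA where
    JA: "insert x3 (D \<inter> A) \<subseteq> JA" "JA \<subseteq> A - X" "gA \<in> JA" "finite JA"
      "card JA \<le> 3 * card (insert x3 (D \<inter> A)) + 1"
    and rA: "\<And>v. v \<in> JA \<Longrightarrow> (gA, v) \<in> (?E \<inter> JA \<times> JA)\<^sup>*"
    by metis
  have "insert y3 (D \<inter> B) \<subseteq> B - X" using x3 DV by auto
  from dense_part_connect[OF B symE n1000 X(1,2) this] obtain JB gB where
    JB: "insert y3 (D \<inter> B) \<subseteq> JB" "JB \<subseteq> B - X" "gB \<in> JB" "finite JB"
      "card JB \<le> 3 * card (insert y3 (D \<inter> B)) + 1"
    and rB: "\<And>v. v \<in> JB \<Longrightarrow> (gB, v) \<in> (?E \<inter> JB \<times> JB)\<^sup>*"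
    by metis
  define I where "I = JA \<union> JB"
  have IV: "I \<subseteq> ?V" "finite I" "gA \<in> I" using JA(2-4) JB(2,4) part by (auto simp: I_def)
  have DI: "D \<subseteq> I" using JA(1) JB(1) DV part by (auto simp: I_def)
  have XI: "X \<inter> I = {}" using JA(2) JB(2) by (auto simp: I_def)
  have cI: "real (card I) \<le> real n / 1000"
  proof -
    have "card I \<le> card JA + card JB" unfolding I_def by (rule card_Un_le)
    moreover have "card (insert x3 (D \<inter> A)) \<le> Suc (card (D \<inter> A))"
      "card (insert y3 (D \<inter> B)) \<le> Suc (card (D \<inter> B))"
      by (rule card_insert_le_m1; simp)+
    ultimately have "card I \<le> 3 * card D + 8"
      using JA(5) JB(5) cDAB by linarith
    \<comment> \<open>The constant is an upper bound for
      \<open>30000 * 40000 + 80000\<close>.\<close>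
    then have "10000 * card I \<le> 3 * n + 1201000000"
      using cardD cD(1) cD1 n(1) by linarith
    then show ?thesis using n' by linarith
  qed
  define F where "F = ?E \<inter> I \<times> I"
  have sF: "sym (F\<^sup>*)"
    using symE by (intro sym_rtrancl) (auto simp: F_def sym_def)
  have FA: "(gA, v) \<in> F\<^sup>*" if "v \<in> JA" for v
    by (rule subsetD[OF rtrancl_mono rA[OF that]]) (auto simp: F_def I_def)
  have FB: "(gB, v) \<in> F\<^sup>*" if "v \<in> JB" for v
    by (rule subsetD[OF rtrancl_mono rB[OF that]]) (auto simp: F_def I_def)
  have "(gA, x3) \<in> F\<^sup>*" "(gB, y3) \<in> F\<^sup>*" "(x3, y3) \<in> F"
    using FA[of x3] FB[of y3] JA(1) JB(1) e(3) by (auto simp: F_def I_def)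
  then have "(gA, gB) \<in> F\<^sup>*"
    using symD[OF sF] by (meson rtrancl.rtrancl_into_rtrancl rtrancl_trans)
  then have reach: "(gA, v) \<in> F\<^sup>*" if "v \<in> I" for v
    using that FA[of v] FB[of v] by (auto simp: I_def intro: rtrancl_trans)
  have xI: "x1 \<in> A - I" "x2 \<in> A - I" "y1 \<in> B - I" "y2 \<in> B - I"
    using XI xy(3,4) by (auto simp: X_def)
  \<comment> \<open>\<open>P\<close> runs from \<open>x1\<close> to \<open>x2\<close> and
    \<open>Q\<close> back from \<open>y2\<close> to \<open>y1\<close>, so \<open>P @ Q\<close> is
    joined by the edge \<open>x2 y2\<close> and closed by \<open>y1 x1\<close>.\<close>
  obtain P where P: "ham_path ?E (A - I) x1 x2 P"
    using dense_part_ham_path[OF A symE irrE n1000 IV(2) cI xI(1,2)] xy(1) by auto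
  obtain Q where Q: "ham_path ?E (B - I) y2 y1 Q"
    using dense_part_ham_path[OF B symE irrE n1000 IV(2) cI xI(4,3)] xy(2) by auto
  have cVI: "card ?V \<le> card (?V - I) + card I"
    using card_Diff_subset[OF IV(2,1)] by linarith
  show ?thesis
  proof (rule generalized_Halin_of_core[OF G IV(1,3)])
    show "(gA, v) \<in> (?E \<inter> I \<times> I)\<^sup>*" if "v \<in> I" for v
      using reach[OF that] by (simp add: F_def)
    show "\<exists>i\<in>I. (v, i) \<in> ?E" if "v \<in> ?V - I" for v
      using dom[of v] that DI by (auto simp: D_def)
    show "3 * card I \<le> card (nbrs ?E i (?V - I))" if "i \<in> I" for i
    proof -
      have "i \<in> ?V" using that IV by blast
      then show ?thesis
        using deg[of i] card_nbrs_Diff_ge[OF finV IV(2), of ?E i] cI n' by linarith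
    qed
    show "distinct (P @ Q)" using P Q part by (auto simp: ham_path_def)
    show set: "set (P @ Q) = ?V - I" using P Q part by (auto simp: ham_path_def)
    show "3 \<le> length (P @ Q)"
    proof -
      have "3 \<le> card (?V - I)" using cVI cI n' n(1) by linarith
      then show ?thesis using card_length[of "P @ Q"] unfolding set by linarith
    qed
    show "successively (\<lambda>u v. (u, v) \<in> ?E) (P @ Q)"
      using P Q e(2) by (simp add: ham_path_def successively_append_iff)
    show "(last (P @ Q), hd (P @ Q)) \<in> ?E"
      using P Q symD[OF symE e(1)] by (simp add: ham_path_def)
  qed
qed

section \<open>Cleaning up the given partition\<close>

text \<open>Sparseness is assumed vertex by vertex only on \<open>V1\<close>, so some vertices of
  \<open>V2\<close> may still see much of \<open>V1\<close>. Double counting shows that they are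
  few; moved over, they are the exceptional vertices of the enlarged part, and the other part is
  left with none.\<close>

lemma dense_parts_of_partition:
  fixes \<beta> :: real
  assumes E: "sym E" and V: "finite V" "card V = n" "V1 \<union> V2 = V" "V1 \<inter> V2 = {}"
    and \<beta>: "0 < \<beta>" "\<beta> \<le> 1 / 10 ^ 6"
    and c1: "(2 / 5 - 4 * \<beta>) * real n \<le> real (card V1)"
    and c2: "(2 / 5 - 4 * \<beta>) * real n \<le> real (card V2)"
    and sparse: "\<And>v. v \<in> V1 \<Longrightarrow> real (card (nbrs E v V2)) \<le> 2 * \<beta> * real n"
    and deg: "\<And>v. v \<in> V \<Longrightarrow> 2 / 5 * real n \<le> real (card (nbrs E v V))"
    and n: "0 < n"
  obtains A B W where "A \<union> B = V" "A \<inter> B = {}" "dense_part E n A W" "dense_part E n B {}"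
proof -
  have fin: "finite V1" "finite V2" using V by auto
  have cV: "card V1 + card V2 = n"
    using card_Un_disjoint[OF fin V(4)] V(2,3) by simp
  have \<beta>n: "0 \<le> \<beta> * real n" "\<beta> * real n \<le> real n / 1000000"
    using \<beta> n mult_right_mono[OF \<beta>(2), of "real n"] by auto
  have c1': "2 / 5 * real n - 4 * (\<beta> * real n) \<le> real (card V1)"
    and c2': "2 / 5 * real n - 4 * (\<beta> * real n) \<le> real (card V2)"
    using c1 c2 by (simp_all add: algebra_simps)
  have cV': "real (card V1) + real (card V2) = real n" using cV by linarith
  \<comment> \<open>The threshold is the degree that \<open>dense_part\<close> asks of exceptional
    vertices.\<close>
  define W where "W = {v \<in> V2. real n / 100 \<le> real (card (nbrs E v V1))}"
  have W: "W \<subseteq> V2" "finite W" using fin by (auto simp: W_def)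
  have cW: "real (card W) \<le> real n / 1000"
  proof -
    \<comment> \<open>Counting pairs between the parts bounds \<open>card W * (n / 100)\<close> by
      \<open>2 * \<beta> * n * n\<close>, so \<open>W\<close> has at most \<open>n / 5000\<close>
      elements.\<close>
    have "real (card W) * (real n / 100) \<le> (\<Sum>v\<in>W. real (card (nbrs E v V1)))"
      using sum_bounded_below[of W "real n / 100" "\<lambda>v. real (card (nbrs E v V1))"]
      by (simp add: W_def)
    also have "\<dots> \<le> (\<Sum>v\<in>V2. real (card (nbrs E v V1)))"
      using fin W by (intro sum_mono2) auto
    also have "\<dots> = real (\<Sum>v\<in>V2. card (nbrs E v V1))" by simp
    also have "\<dots> = real (\<Sum>v\<in>V1. card (nbrs E v V2))"
      using sum_card_nbrs_swap[OF E fin(2,1)] by simp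
    also have "\<dots> = (\<Sum>v\<in>V1. real (card (nbrs E v V2)))" by simp
    also have "\<dots> \<le> real (card V1) * (2 * \<beta> * real n)"
      using sum_bounded_above[of V1 "\<lambda>v. real (card (nbrs E v V2))"] sparse by simp
    also have "\<dots> \<le> real n * (2 * \<beta> * real n)"
      using cV' \<beta>n by (intro mult_right_mono) auto
    finally have "real (card W) / 100 * real n \<le> (2 * \<beta> * real n) * real n"
      by (simp add: algebra_simps)
    then have "real (card W) / 100 \<le> 2 * \<beta> * real n"
      using n by (simp add: mult_le_cancel_right)
    then show ?thesis using \<beta>n by simp
  qed
  have "dense_part E n (V1 \<union> W) W"
    unfolding dense_part_def
  proof (intro conjI ballI)
    \<comment> \<open>The upper bound on one part comes from the lower bound on the other, up to the
      vertices moved.\<close>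
    have "card V1 \<le> card (V1 \<union> W)" "card (V1 \<union> W) \<le> card V1 + card W"
      using fin W by (auto intro: card_mono card_Un_le)
    then have "real (card V1) \<le> real (card (V1 \<union> W))"
      "real (card (V1 \<union> W)) \<le> real (card V1) + real (card W)"
      by linarith+
    then show "38 / 100 * real n \<le> real (card (V1 \<union> W))"
      "real (card (V1 \<union> W)) \<le> 62 / 100 * real n"
      using c1' c2' cV' cW \<beta>n by linarith+
    fix v
    have m: "card (nbrs E v V1) \<le> card (nbrs E v (V1 \<union> W))"
      using fin W by (intro card_nbrs_mono) auto
    {
      assume "v \<in> W"
      then show "real n / 100 \<le> real (card (nbrs E v (V1 \<union> W)))"
        using m by (auto simp: W_def)
    next
      assume "v \<in> V1 \<union> W - W"
      then have v: "v \<in> V1" "v \<in> V" using V(3) by auto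
      have "card (nbrs E v V) \<le> card (nbrs E v V1) + card (nbrs E v V2)"
        using card_nbrs_Un_le[OF fin, of E v] V(3) by simp
      then show "38 / 100 * real n \<le> real (card (nbrs E v (V1 \<union> W)))"
        using m deg[OF v(2)] sparse[OF v(1)] \<beta>n by linarith
    }
  qed (use fin W cW in auto)
  moreover have "dense_part E n (V2 - W) {}"
    unfolding dense_part_def
  proof (intro conjI ballI)
    have "card (V2 - W) \<le> card V2" "card V2 \<le> card (V2 - W) + card W"
      using fin W card_Diff_subset[OF W(2,1)] by (auto intro: card_mono)
    then have "real (card (V2 - W)) \<le> real (card V2)"
      "real (card V2) \<le> real (card (V2 - W)) + real (card W)"
      by linarith+
    then show "38 / 100 * real n \<le> real (card (V2 - W))"
      "real (card (V2 - W)) \<le> 62 / 100 * real n"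
      using c1' c2' cV' cW \<beta>n by linarith+
    \<comment> \<open>Such a vertex loses at most \<open>n / 100\<close> neighbours to
      \<open>V1\<close> and \<open>n / 1000\<close> to \<open>W\<close>.\<close>
    fix v assume v: "v \<in> V2 - W - {}"
    then have "v \<in> V" "real (card (nbrs E v V1)) \<le> real n / 100"
      using V(3) by (auto simp: W_def)
    moreover have "card (nbrs E v V) \<le> card (nbrs E v V1) + card (nbrs E v V2)"
      using card_nbrs_Un_le[OF fin, of E v] V(3) by simp
    moreover have "card (nbrs E v V2) \<le> card (nbrs E v (V2 - W)) + card W"
      by (rule card_nbrs_Diff_ge) fact+
    ultimately show "38 / 100 * real n \<le> real (card (nbrs E v (V2 - W)))"
      using deg[of v] cW by linarith
  qed (use fin in auto)
  moreover have "V1 \<union> W \<union> (V2 - W) = V" "(V1 \<union> W) \<inter> (V2 - W) = {}"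
    using V(3,4) W(1) by auto
  ultimately show thesis using that by blast
qed

lemma min_degree_le:
  assumes "pair_graph G" "v \<in> pverts G"
  shows "min_degree G \<le> card (nbrs (parcs G) v (pverts G))"
proof -
  interpret pair_graph G by fact
  have "{u. (v, u) \<in> parcs G} = nbrs (parcs G) v (pverts G)"
    by (auto simp: nbrs_def dest: in_arcsD2)
  then show ?thesis
    unfolding min_degree_def out_degree_with_proj[symmetric]
    using assms(2) pair_finite_verts by (metis Min_le finite_imageI imageI out_degree_with_proj)
qed

theorem theorem4p2:
  shows "\<exists>\<alpha>0>0::real. \<forall>\<alpha>. 0 < \<alpha> \<and> \<alpha> \<le> \<alpha>0 \<longrightarrow>
    (\<exists>\<beta>0>0::real. \<forall>\<beta>. 0 < \<beta> \<and> \<beta> \<le> \<beta>0 \<longrightarrow>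
      (\<exists>n0::nat. \<forall>n\<ge>n0. \<forall>G :: 'a pair_pre_digraph.
        pair_graph G \<and> card (pverts G) = n \<and> k_connected 3 G \<and>
        real (min_degree G) \<ge> (2 * real n + 3) / 5 \<and>
        (\<exists>V1 V2. V1 \<union> V2 = pverts G \<and> V1 \<inter> V2 = {} \<and>
           real (card V1) \<ge> (2 / 5 - 4 * \<beta>) * real n \<and>
           real (card V2) \<ge> (2 / 5 - 4 * \<beta>) * real n \<and>
           density G V1 V2 < \<alpha> \<and>
           (\<forall>v1\<in>V1. real (deg_in G v1 V2) \<le> 2 * \<beta> * real n))
        \<longrightarrow> (\<exists>H. spanning_generalized_Halin H G)))"
proof (rule exI[of _ 1], intro conjI allI impI)
  fix \<alpha> :: real
  show "\<exists>\<beta>0>0::real. \<forall>\<beta>. 0 < \<beta> \<and> \<beta> \<le> \<beta>0 \<longrightarrow>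
      (\<exists>n0::nat. \<forall>n\<ge>n0. \<forall>G :: 'a pair_pre_digraph.
        pair_graph G \<and> card (pverts G) = n \<and> k_connected 3 G \<and>
        real (min_degree G) \<ge> (2 * real n + 3) / 5 \<and>
        (\<exists>V1 V2. V1 \<union> V2 = pverts G \<and> V1 \<inter> V2 = {} \<and>
           real (card V1) \<ge> (2 / 5 - 4 * \<beta>) * real n \<and>
           real (card V2) \<ge> (2 / 5 - 4 * \<beta>) * real n \<and>
           density G V1 V2 < \<alpha> \<and>
           (\<forall>v1\<in>V1. real (deg_in G v1 V2) \<le> 2 * \<beta> * real n))
        \<longrightarrow> (\<exists>H. spanning_generalized_Halin H G))"
  \<comment> \<open>This bound on \<beta> keeps the set of moved vertices small:
    \<open>200 * \<beta> * n\<close> is at most \<open>n / 5000\<close>.\<close>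
  proof (rule exI[of _ "1 / 10 ^ 6"], intro conjI allI impI)
    fix \<beta> :: real
    assume \<beta>: "0 < \<beta> \<and> \<beta> \<le> 1 / 10 ^ 6"
    show "\<exists>n0::nat. \<forall>n\<ge>n0. \<forall>G :: 'a pair_pre_digraph.
        pair_graph G \<and> card (pverts G) = n \<and> k_connected 3 G \<and>
        real (min_degree G) \<ge> (2 * real n + 3) / 5 \<and>
        (\<exists>V1 V2. V1 \<union> V2 = pverts G \<and> V1 \<inter> V2 = {} \<and>
           real (card V1) \<ge> (2 / 5 - 4 * \<beta>) * real n \<and>
           real (card V2) \<ge> (2 / 5 - 4 * \<beta>) * real n \<and>
           density G V1 V2 < \<alpha> \<and>
           (\<forall>v1\<in>V1. real (deg_in G v1 V2) \<le> 2 * \<beta> * real n))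
        \<longrightarrow> (\<exists>H. spanning_generalized_Halin H G)"
    \<comment> \<open>The threshold absorbs the additive constants, mainly the up to 40000 vertices
      of the second dominating set.\<close>
    proof (rule exI[of _ "10 ^ 9"], intro allI impI, elim conjE exE)
      fix n :: nat and G :: "'a pair_pre_digraph" and V1 V2
      assume n: "10 ^ 9 \<le> n" "card (pverts G) = n" and G: "pair_graph G" "k_connected 3 G"
        and deg: "(2 * real n + 3) / 5 \<le> real (min_degree G)"
        and V: "V1 \<union> V2 = pverts G" "V1 \<inter> V2 = {}"
        and c: "(2 / 5 - 4 * \<beta>) * real n \<le> real (card V1)"
          "(2 / 5 - 4 * \<beta>) * real n \<le> real (card V2)"
        and sparse: "\<forall>v1\<in>V1. real (deg_in G v1 V2) \<le> 2 * \<beta> * real n"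
      interpret pair_graph G by fact
      have symE: "sym (parcs G)" using pair_sym_arcs by (simp add: symmetric_def)
      have d: "2 / 5 * real n \<le> real (card (nbrs (parcs G) v (pverts G)))"
        if "v \<in> pverts G" for v
      proof -
        have "real (min_degree G) \<le> real (card (nbrs (parcs G) v (pverts G)))"
          using min_degree_le[OF G(1) that] by (rule of_nat_mono)
        moreover have "2 / 5 * real n \<le> (2 * real n + 3) / 5" by simp
        ultimately show ?thesis using deg by linarith
      qed
      have sp: "real (card (nbrs (parcs G) v V2)) \<le> 2 * \<beta> * real n" if "v \<in> V1" for v
        using sparse that by (simp add: deg_in_def nbrs_def)
      have n0: "0 < n" using n(1) by (cases n) auto
      obtain A B W where AB: "A \<union> B = pverts G" "A \<inter> B = {}"
        "dense_part (parcs G) n A W" "dense_part (parcs G) n B {}"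
        using dense_parts_of_partition[OF symE pair_finite_verts n(2) V conjunct1[OF \<beta>]
            conjunct2[OF \<beta>] c sp d n0] by blast
      show "\<exists>H. spanning_generalized_Halin H G"
      proof (rule generalized_Halin_of_dense_parts[OF G n(2,1) AB])
        show "39 / 100 * real n \<le> real (card (nbrs (parcs G) v (pverts G)))"
          if "v \<in> pverts G" for v
          using d[OF that] by linarith
      qed
    qed
  qed simp
qed simp

end
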